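(* Let $\{Z_n:n\geq 0\}$ be a critical Galton--Watson process (constant environment) with offspring law $q$ on $\mathbb{N}_0$ satisfying $q[0]+q[1]<1$ and $q[k]\neq 1$ for all $k\in\mathbb{N}_0$, with mean $\mathbb{E}[Z_1]=1$, variance $\sigma^2:=\mathrm{Var}(Z_1)<\infty$ and $\mathbb{E}[(Z_1)^3]<\infty$. Then there exists a constant $C>0$, independent of $n$, such that for all $n\geq 2$ $$d_W\left(\left\{\left.\frac{2}{\sigma^2 n}Z_n\ \right|\ Z_n>0\right\},\mathbf{e}\right)\leq C\,\frac{\log(n)}{n}$$ and $$d_W\left(\left\{\left.\mathbb{P}[Z_n>0]\,Z_n\ \right|\ Z_n>0\right\},\mathbf{e}\right)\leq C\,\frac{\log(n)}{n},$$ where $\mathbf{e}$ is a standard exponential random variable.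
   Context: $\mathbb{N}_0=\{0,1,2,\dots\}$. For a probability measure $q$ on $\mathbb{N}_0$, write $q[k]$ for the mass at $k$. The Galton--Watson process with offspring law $q$ is defined by $Z_0=1$ and $Z_n=\sum_{i=1}^{Z_{n-1}}\chi_i^{(n)}$ for $n\ge 1$, where $\{\chi_i^{(n)}: i,n\ge 1\}$ are i.i.d. with law $q$. It is critical if $\mathbb{E}[Z_1]=1$. $\{X\mid Z_n>0\}$ denotes (a random variable having) the conditional law of $X$ given the event $\{Z_n>0\}$. The Wasserstein distance between probability measures $\mu,\nu$ on $\mathbb{R}$ is $d_W(\mu,\nu)=\sup_{f\in\mathcal{F}}\left|\int f\,d\mu-\int f\,d\nu\right|$, where $\mathcal{F}$ is the set of Lipschitz functions $f:\mathbb{R}\to\mathbb{R}$ with $\|f'\|_\infty\leq 1$. For random variables, $d_W(X,Y)$ means the distance between their laws. *)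

theory Defs
  imports "HOL-Probability.Probability"
begin

text \<open>
  \<open>\<xi> i n\<close> is the number of children of the \<open>i\<close>-th individual of generation \<open>n - 1\<close>;
  both indices start at 1.
\<close>

locale galton_watson = prob_space M
  for M :: "'a measure" +
  fixes q :: "nat pmf"
    and \<xi> :: "nat \<Rightarrow> nat \<Rightarrow> 'a \<Rightarrow> nat"
    and Z :: "nat \<Rightarrow> 'a \<Rightarrow> nat"
  assumes offspring_indep:
      "indep_vars (\<lambda>_. count_space UNIV) (\<lambda>(i, n). \<xi> i n) ({1..} \<times> {1..})"
    and offspring_law:
      "\<And>i n. i \<ge> 1 \<Longrightarrow> n \<ge> 1 \<Longrightarrow> distr M (count_space UNIV) (\<xi> i n) = measure_pmf q"
    and Z_0: "\<And>\<omega>. \<omega> \<in> space M \<Longrightarrow> Z 0 \<omega> = 1"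
    and Z_step:
      "\<And>n \<omega>. n \<ge> 1 \<Longrightarrow> \<omega> \<in> space M \<Longrightarrow> Z n \<omega> = (\<Sum>i = 1..Z (n - 1) \<omega>. \<xi> i n \<omega>)"

definition cond_law :: "'a measure \<Rightarrow> ('a \<Rightarrow> real) \<Rightarrow> ('a \<Rightarrow> bool) \<Rightarrow> real measure" where
  "cond_law M X P = distr (uniform_measure M {\<omega> \<in> space M. P \<omega>}) borel X"

text \<open>
  A Lipschitz function is differentiable almost everywhere, so the differentiability conjunct
  excludes no Lipschitz function; it is there because \<open>deriv\<close> is
  meaningless at points of non-differentiability.
\<close>

definition wasserstein_test :: "(real \<Rightarrow> real) set" where
  "wasserstein_test =
     {f. (\<exists>L. L-lipschitz_on UNIV f) \<and>
         (AE x in lborel. f differentiable (at x) \<and> \<bar>deriv f x\<bar> \<le> 1)}"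

text \<open>
  The supremum is taken in the extended reals, hence it is meaningful without a boundedness
  side condition. The definition is intended for probability measures with finite first moment,
  for which every Lipschitz function is integrable.
\<close>

definition wasserstein_dist :: "real measure \<Rightarrow> real measure \<Rightarrow> ereal" where
  "wasserstein_dist \<mu> \<nu> =
     (SUP f \<in> wasserstein_test. ereal \<bar>(\<integral>x. f x \<partial>\<mu>) - (\<integral>x. f x \<partial>\<nu>)\<bar>)"

end

theory Submission
  imports Defs
begin

text \<open>
  Write \<open>p\<^sub>n = \<P>(Z\<^sub>n > 0)\<close>. By Stein's method, \<open>p\<^sub>n Z\<^sub>n\<close> given \<open>Z\<^sub>n > 0\<close> is close to exponential as
  soon as \<open>Z\<^sub>n\<close> given \<open>Z\<^sub>n > 0\<close> is close to its equilibrium law, which by criticality has mass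
  \<open>\<P>(Z\<^sub>n > k)\<close> at \<open>k\<close>. Conditioning on the first generation, both laws at time \<open>n + 1\<close> arise from
  those at time \<open>n\<close> by convolution with laws that differ by \<open>O(p\<^sub>n)\<close> in Wasserstein distance, so the
  distance at time \<open>n\<close> is \<open>O(p\<^sub>0 + \<dots> + p\<^sub>n\<^sub>-\<^sub>1) = O(log n)\<close>; rescaling by \<open>p\<^sub>n = O(1/n)\<close> gives the second
  claim. The first follows since \<open>1/p\<^sub>n\<close> has increments \<open>\<sigma>\<^sup>2/2 + O(p\<^sub>n)\<close>.
\<close>

section \<open>Expectations under probability mass functions\<close>

text \<open>The logarithm is the price of a recursion without damping: the discrepancy at one time
  enters the next with coefficient one, the mean number of families, so the errors of the single
  steps only add up. The rate survives because the discrepancy is measured before rescaling, on the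
  lattice of counts. There a step costs \<open>O(p\<^sub>n)\<close>, the costs sum to a harmonic
  series, and the final multiplication by \<open>p\<^sub>n\<close> supplies the factor
  \<open>1/n\<close>.

  Distances are treated in dual form, through linear functionals of 1-Lipschitz functions, so no
  coupling is built. The test functions are unbounded and have to be recentred; this is possible
  because the two functionals have equal total mass.

  Survival is estimated twice. The precise increment of \<open>1/p\<^sub>n\<close> carries an error
  \<open>O(p\<^sub>n)\<close>, which is under control only once \<open>p\<^sub>n = O(1/n)\<close> is
  known; that bound comes beforehand from a cruder quadratic inequality with constant
  \<open>pmf q 0\<close>.\<close>

lemma integrable_bind_pmfI:
  fixes f :: "'b \<Rightarrow> real" and F :: "'a \<Rightarrow> 'b pmf"
  assumes "\<And>x. x \<in> set_pmf p \<Longrightarrow> integrable (F x) f"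
    and "integrable p (\<lambda>x. measure_pmf.expectation (F x) (\<lambda>y. \<bar>f y\<bar>))"
  shows "integrable (bind_pmf p F) f"
proof (rule integrableI_bounded)
  have "(\<integral>\<^sup>+y. ennreal (norm (f y)) \<partial>bind_pmf p F) = (\<integral>\<^sup>+x. \<integral>\<^sup>+y. ennreal \<bar>f y\<bar> \<partial>F x \<partial>p)"
    by simp
  also have "\<dots> = (\<integral>\<^sup>+x. ennreal (measure_pmf.expectation (F x) (\<lambda>y. \<bar>f y\<bar>)) \<partial>p)"
    using assms(1) by (intro nn_integral_cong_AE AE_pmfI nn_integral_eq_integral) auto
  also have "\<dots> < \<infinity>"
    using integrableD(2)[OF assms(2)] by (simp add: abs_of_nonneg less_top)
  finally show "(\<integral>\<^sup>+y. ennreal (norm (f y)) \<partial>bind_pmf p F) < \<infinity>" .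
qed simp

lemma
  fixes f :: "'b \<Rightarrow> real" and F :: "'a \<Rightarrow> 'b pmf"
  assumes f: "integrable (bind_pmf p F) f"
  shows integrable_bind_pmfD: "integrable p (\<lambda>x. measure_pmf.expectation (F x) f)"
    and expectation_bind_pmf: "measure_pmf.expectation (bind_pmf p F) f
          = measure_pmf.expectation p (\<lambda>x. measure_pmf.expectation (F x) f)"
proof -
  have fin: "(\<integral>\<^sup>+x. \<integral>\<^sup>+y. ennreal \<bar>f y\<bar> \<partial>F x \<partial>p) < \<infinity>"
    using f by (simp add: integrable_iff_bounded)
  then have "AE x in p. (\<integral>\<^sup>+y. ennreal \<bar>f y\<bar> \<partial>F x) \<noteq> \<infinity>"
    by (intro nn_integral_PInf_AE) auto
  then have D1: "integrable (F x) f" if "x \<in> set_pmf p" for x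
    using that by (auto simp: AE_measure_pmf_iff less_top intro!: integrableI_bounded)
  \<comment> \<open>For \<open>0 \<le> g \<le> \<bar>f\<bar>\<close> the identity is one of
    nonnegative integrals, finite by domination. The signed case follows by applying it to the
    positive and negative parts of \<open>f\<close>.\<close>
  have nn: "integrable p (\<lambda>x. measure_pmf.expectation (F x) g) \<and>
      measure_pmf.expectation (bind_pmf p F) g
      = measure_pmf.expectation p (\<lambda>x. measure_pmf.expectation (F x) g)"
    if g: "\<And>y. 0 \<le> g y" "\<And>y. g y \<le> \<bar>f y\<bar>" for g
  proof -
    have gi: "integrable (F x) g" if "x \<in> set_pmf p" for x
      using D1[OF that] by (rule Bochner_Integration.integrable_bound) (use g in \<open>auto intro!: AE_I2\<close>)
    have gb: "integrable (bind_pmf p F) g"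
      using f by (rule Bochner_Integration.integrable_bound) (use g in \<open>auto intro!: AE_I2\<close>)
    have eq: "(\<integral>\<^sup>+x. ennreal (measure_pmf.expectation (F x) g) \<partial>p) = (\<integral>\<^sup>+y. ennreal (g y) \<partial>bind_pmf p F)"
      unfolding nn_integral_bind_pmf using gi g
      by (intro nn_integral_cong_AE AE_pmfI nn_integral_eq_integral[symmetric]) auto
    also have "\<dots> < \<infinity>"
      using integrableD(2)[OF gb] g(1) by (simp add: less_top)
    finally have "integrable p (\<lambda>x. measure_pmf.expectation (F x) g)"
      using g(1) by (intro integrableI_bounded) (auto simp: abs_of_nonneg)
    then show ?thesis
      using eq g(1) by (auto simp: integral_eq_nn_integral simp del: nn_integral_bind_pmf)
  qed
  have pos: "integrable p (\<lambda>x. measure_pmf.expectation (F x) (\<lambda>y. max 0 (f y))) \<and>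
      measure_pmf.expectation (bind_pmf p F) (\<lambda>y. max 0 (f y))
      = measure_pmf.expectation p (\<lambda>x. measure_pmf.expectation (F x) (\<lambda>y. max 0 (f y)))"
    by (rule nn) auto
  have neg: "integrable p (\<lambda>x. measure_pmf.expectation (F x) (\<lambda>y. max 0 (- f y))) \<and>
      measure_pmf.expectation (bind_pmf p F) (\<lambda>y. max 0 (- f y))
      = measure_pmf.expectation p (\<lambda>x. measure_pmf.expectation (F x) (\<lambda>y. max 0 (- f y)))"
    by (rule nn) auto
  have split: "measure_pmf.expectation r f = measure_pmf.expectation r (\<lambda>y. max 0 (f y))
      - measure_pmf.expectation r (\<lambda>y. max 0 (- f y))" if r: "integrable r f" for r :: "'b pmf"
  proof -
    have "integrable r (\<lambda>y. max 0 (f y))" "integrable r (\<lambda>y. max 0 (- f y))"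
      by (rule Bochner_Integration.integrable_bound[OF r], auto)+
    then have "measure_pmf.expectation r (\<lambda>y. max 0 (f y)) - measure_pmf.expectation r (\<lambda>y. max 0 (- f y))
        = measure_pmf.expectation r (\<lambda>y. max 0 (f y) - max 0 (- f y))"
      by simp
    also have "(\<lambda>y. max 0 (f y) - max 0 (- f y)) = f"
      by (auto simp: max_def)
    finally show ?thesis by simp
  qed
  have cong: "AE x in p. measure_pmf.expectation (F x) (\<lambda>y. max 0 (f y))
      - measure_pmf.expectation (F x) (\<lambda>y. max 0 (- f y)) = measure_pmf.expectation (F x) f"
    by (rule AE_pmfI) (simp add: split[OF D1])
  have "integrable p (\<lambda>x. measure_pmf.expectation (F x) (\<lambda>y. max 0 (f y))
      - measure_pmf.expectation (F x) (\<lambda>y. max 0 (- f y)))"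
    using pos neg by auto
  then show "integrable p (\<lambda>x. measure_pmf.expectation (F x) f)"
    by (rule integrable_cong_AE_imp) (use cong in auto)
  have "measure_pmf.expectation (bind_pmf p F) f
     = measure_pmf.expectation p (\<lambda>x. measure_pmf.expectation (F x) (\<lambda>y. max 0 (f y))
      - measure_pmf.expectation (F x) (\<lambda>y. max 0 (- f y)))"
    using pos neg by (simp add: split[OF f])
  also have "\<dots> = measure_pmf.expectation p (\<lambda>x. measure_pmf.expectation (F x) f)"
    by (rule integral_cong_AE) (use cong in auto)
  finally show "measure_pmf.expectation (bind_pmf p F) f
     = measure_pmf.expectation p (\<lambda>x. measure_pmf.expectation (F x) f)" .
qed

lemma integrable_pmf_indicator: "integrable (measure_pmf \<mu>) (indicator A :: 'b \<Rightarrow> real)"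
  by (rule measure_pmf.integrable_const_bound[where B = 1]) auto

lemma expectation_abs_le_const:
  fixes f :: "'b \<Rightarrow> real"
  assumes "\<And>x. \<bar>f x\<bar> \<le> c"
  shows "\<bar>measure_pmf.expectation \<mu> f\<bar> \<le> c"
proof -
  have "\<bar>measure_pmf.expectation \<mu> f\<bar> \<le> measure_pmf.expectation \<mu> (\<lambda>x. \<bar>f x\<bar>)"
    by (rule integral_abs_bound)
  also have "\<dots> \<le> c"
    using assms by (intro measure_pmf.integral_le_const)
      (auto intro!: measure_pmf.integrable_const_bound[where B = c])
  finally show ?thesis .
qed

lemma integrable_lower_power:
  assumes "integrable (measure_pmf \<mu>) (\<lambda>z. real z ^ 3)"
  shows "integrable (measure_pmf \<mu>) (\<lambda>z. real z ^ 2)"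
proof (rule Bochner_Integration.integrable_bound[OF assms])
  show "AE z in \<mu>. norm (real z ^ 2) \<le> norm (real z ^ 3)"
  proof (intro AE_I2)
    show "norm (real z ^ 2) \<le> norm (real z ^ 3)" for z
      by (cases z) (auto intro: power_increasing)
  qed
qed simp

section \<open>Convolution powers and the Galton--Watson recursion\<close>

primrec conv_power :: "nat pmf \<Rightarrow> nat \<Rightarrow> nat pmf" where
  "conv_power \<mu> 0 = return_pmf 0"
| "conv_power \<mu> (Suc k) = bind_pmf (conv_power \<mu> k) (\<lambda>s. map_pmf (\<lambda>z. s + z) \<mu>)"

lemma conv_power_add:
  "conv_power \<mu> (i + j) = bind_pmf (conv_power \<mu> i) (\<lambda>s. map_pmf (\<lambda>z. s + z) (conv_power \<mu> j))"
proof (induction j)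
  case 0
  show ?case by (simp add: bind_return_pmf')
next
  case (Suc j)
  then show ?case
    by (simp add: bind_assoc_pmf map_bind_pmf bind_map_pmf pmf.map_comp o_def add.assoc[abs_def])
qed

text \<open>The branching property: when the members of \<open>k\<close> independent groups
  reproduce, the result is \<open>k\<close> independent groups of offspring. In the induction step
  the size \<open>j\<close> of the last group and the offspring of the first \<open>i\<close>
  individuals are independent draws, hence may be exchanged.\<close>

lemma conv_power_bind:
  "bind_pmf (conv_power \<mu> k) (conv_power q) = conv_power (bind_pmf \<mu> (conv_power q)) k"
proof (induction k)
  case 0
  show ?case by (simp add: bind_return_pmf)
next
  case (Suc k)
  have "bind_pmf (conv_power \<mu> (Suc k)) (conv_power q)
      = bind_pmf (conv_power \<mu> k) (\<lambda>i. bind_pmf \<mu> (\<lambda>j. bind_pmf (conv_power q i)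
          (\<lambda>s. map_pmf (\<lambda>z. s + z) (conv_power q j))))"
    by (simp add: bind_assoc_pmf bind_map_pmf conv_power_add)
  also have "\<dots> = bind_pmf (conv_power \<mu> k) (\<lambda>i. bind_pmf (conv_power q i) (\<lambda>s. bind_pmf \<mu>
          (\<lambda>j. map_pmf (\<lambda>z. s + z) (conv_power q j))))"
    by (subst (2) bind_commute_pmf) simp
  also have "\<dots> = conv_power (bind_pmf \<mu> (conv_power q)) (Suc k)"
    by (simp add: Suc[symmetric] bind_assoc_pmf map_bind_pmf)
  finally show ?case .
qed

text \<open>The recursion is at the root: each child of the ancestor starts its own copy of the
  process. This is the form that the discrepancy step and the recursion for survival use. The
  process itself grows at the last generation; \<open>gw_law_Suc'\<close> reconciles the
  two.\<close>

primrec gw_law :: "nat pmf \<Rightarrow> nat \<Rightarrow> nat pmf" where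
  "gw_law q 0 = return_pmf 1"
| "gw_law q (Suc n) = bind_pmf q (conv_power (gw_law q n))"

lemma gw_law_Suc': "gw_law q (Suc n) = bind_pmf (gw_law q n) (conv_power q)"
proof (induction n)
  case 0
  have "conv_power (return_pmf 1) = return_pmf"
  proof
    show "conv_power (return_pmf 1) k = return_pmf k" for k
      by (induction k) (auto simp: bind_return_pmf)
  qed
  moreover have "map_pmf ((+) (0::nat)) q = q"
    by (simp add: pmf.map_ident_strong)
  ultimately show ?case by (simp add: bind_return_pmf bind_return_pmf')
next
  case (Suc n)
  have "bind_pmf (gw_law q (Suc n)) (conv_power q)
      = bind_pmf q (conv_power (bind_pmf (gw_law q n) (conv_power q)))"
    by (simp add: bind_assoc_pmf conv_power_bind)
  also have "\<dots> = gw_law q (Suc (Suc n))"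
    by (simp only: Suc[symmetric] gw_law.simps(2)[of q "Suc n"])
  finally show ?case by simp
qed

section \<open>Moments, and integrability from growth bounds\<close>

lemma integrable_quadratic_growth:
  fixes g :: "nat \<Rightarrow> real"
  assumes "integrable (measure_pmf \<mu>) (\<lambda>z. real z ^ 2)" and "\<And>z. \<bar>g z\<bar> \<le> a * (1 + real z ^ 2)"
  shows "integrable (measure_pmf \<mu>) g"
proof (rule Bochner_Integration.integrable_bound)
  show "integrable (measure_pmf \<mu>) (\<lambda>z. a * (1 + real z ^ 2))"
    using assms(1) by simp
  show "AE z in \<mu>. norm (g z) \<le> norm (a * (1 + real z ^ 2))"
    using order_trans[OF assms(2) abs_ge_self] by (auto intro: AE_I2)
qed simp

lemma le_one_plus_square: "real z \<le> 1 + real z ^ 2"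
  using zero_le_power2[of "real z - 1/2"] by (simp add: power2_eq_square algebra_simps)

lemma linear_le_quadratic:
  assumes "\<bar>x\<bar> \<le> c + real z" shows "\<bar>x\<bar> \<le> (\<bar>c\<bar> + 1) * (1 + real z ^ 2)"
proof -
  have "(\<bar>c\<bar> + 1) * (1 + real z ^ 2) = \<bar>c\<bar> + \<bar>c\<bar> * real z ^ 2 + (1 + real z ^ 2)"
    by (simp add: algebra_simps)
  moreover have "0 \<le> \<bar>c\<bar> * real z ^ 2" by simp
  ultimately show ?thesis using assms le_one_plus_square[of z] by linarith
qed

lemma integrable_linear_growth:
  fixes g :: "nat \<Rightarrow> real"
  assumes "integrable (measure_pmf \<mu>) (\<lambda>z. real z ^ 2)" and "\<And>z. \<bar>g z\<bar> \<le> a + real z"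
  shows "integrable (measure_pmf \<mu>) g"
  by (rule integrable_quadratic_growth[OF assms(1) linear_le_quadratic[OF assms(2)]])

lemma integrable_real_of_square:
  "integrable (measure_pmf \<mu>) (\<lambda>z. real z ^ 2) \<Longrightarrow> integrable (measure_pmf \<mu>) real"
  by (erule integrable_linear_growth[where a = 0]) simp

text \<open>The second moment is made explicit because a mixture over \<open>k\<close> has a finite
  second moment only if this one grows at most quadratically in \<open>k\<close>.\<close>

lemma conv_power_moments:
  assumes sq: "integrable (measure_pmf \<mu>) (\<lambda>z. real z ^ 2)"
    and mean: "measure_pmf.expectation \<mu> real = 1"
  shows "integrable (conv_power \<mu> k) (\<lambda>z. real z ^ 2)
    \<and> measure_pmf.expectation (conv_power \<mu> k) real = real k
    \<and> measure_pmf.expectation (conv_power \<mu> k) (\<lambda>z. real z ^ 2)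
        = real k * (real k - 1) + real k * measure_pmf.expectation \<mu> (\<lambda>z. real z ^ 2)"
    (is "?I k \<and> ?E k \<and> ?V k")
proof (induction k)
  case 0
  show ?case by (simp add: integrable_measure_pmf_finite)
next
  case (Suc k)
  let ?m2 = "measure_pmf.expectation \<mu> (\<lambda>z. real z ^ 2)"
  note int = integrable_real_of_square[OF sq]
  have IH: "?I k" "?E k" "?V k" using Suc by blast+
  note IH1 = integrable_real_of_square[OF IH(1)]
  have e2: "integrable \<mu> (\<lambda>z. real (s + z) ^ 2)"
    "measure_pmf.expectation \<mu> (\<lambda>z. real (s + z) ^ 2) = real s ^ 2 + 2 * real s + ?m2" for s
  proof -
    have "(\<lambda>z. real (s + z) ^ 2) = (\<lambda>z. real s ^ 2 + 2 * real s * real z + real z ^ 2)"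
      by (auto simp: power2_sum)
    then show "integrable \<mu> (\<lambda>z. real (s + z) ^ 2)"
      "measure_pmf.expectation \<mu> (\<lambda>z. real (s + z) ^ 2) = real s ^ 2 + 2 * real s + ?m2"
      using sq int mean by auto
  qed
  have e1: "measure_pmf.expectation \<mu> (\<lambda>z. real (s + z)) = real s + 1" for s
    using int mean by simp
  have I: "?I (Suc k)"
    unfolding conv_power.simps
  proof (rule integrable_bind_pmfI)
    show "integrable (conv_power \<mu> k)
        (\<lambda>s. measure_pmf.expectation (map_pmf ((+) s) \<mu>) (\<lambda>z. \<bar>real z ^ 2\<bar>))"
      using IH(1) IH1 unfolding integral_map_pmf abs_power2 e2 by simp
  qed (use e2 in simp)
  moreover have "?E (Suc k)"
    using integrable_real_of_square[OF I] IH(2) IH1 unfolding conv_power.simps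
    by (subst expectation_bind_pmf) (auto simp: e1 simp del: of_nat_add)
  moreover have "?V (Suc k)"
    using I IH IH1 unfolding conv_power.simps
    by (subst expectation_bind_pmf) (auto simp: e2 algebra_simps simp del: of_nat_add)
  ultimately show ?case by blast
qed

lemma expectation_conv_power_Suc:
  fixes g :: "nat \<Rightarrow> real"
  assumes sq: "integrable (measure_pmf \<mu>) (\<lambda>z. real z ^ 2)"
    and mean: "measure_pmf.expectation \<mu> real = 1"
    and g: "\<And>z. \<bar>g z\<bar> \<le> a * (1 + real z ^ 2)"
  shows "measure_pmf.expectation (conv_power \<mu> (Suc k)) g
    = measure_pmf.expectation (conv_power \<mu> k) (\<lambda>s. measure_pmf.expectation \<mu> (\<lambda>z. g (s + z)))"
    and "integrable (conv_power \<mu> k) (\<lambda>s. measure_pmf.expectation \<mu> (\<lambda>z. g (s + z)))"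
proof -
  have "integrable (conv_power \<mu> (Suc k)) g"
    using integrable_quadratic_growth[OF _ g] conv_power_moments[OF sq mean] by blast
  then have i: "integrable (bind_pmf (conv_power \<mu> k) (\<lambda>s. map_pmf (\<lambda>z. s + z) \<mu>)) g" by simp
  show "measure_pmf.expectation (conv_power \<mu> (Suc k)) g
    = measure_pmf.expectation (conv_power \<mu> k) (\<lambda>s. measure_pmf.expectation \<mu> (\<lambda>z. g (s + z)))"
    using expectation_bind_pmf[OF i] by simp
  show "integrable (conv_power \<mu> k) (\<lambda>s. measure_pmf.expectation \<mu> (\<lambda>z. g (s + z)))"
    using integrable_bind_pmfD[OF i] by simp
qed

lemma bind_conv_power_moments:
  assumes q2: "integrable (measure_pmf q) (\<lambda>z. real z ^ 2)"
    and q1: "measure_pmf.expectation q real = 1"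
    and sq: "integrable (measure_pmf \<mu>) (\<lambda>z. real z ^ 2)"
    and mean: "measure_pmf.expectation \<mu> real = 1"
  shows "integrable (bind_pmf q (conv_power \<mu>)) (\<lambda>z. real z ^ 2)"
    and "measure_pmf.expectation (bind_pmf q (conv_power \<mu>)) real = 1"
proof -
  note m = conv_power_moments[OF sq mean]
  show I: "integrable (bind_pmf q (conv_power \<mu>)) (\<lambda>z. real z ^ 2)"
    using q2 integrable_real_of_square[OF q2] m
    by (intro integrable_bind_pmfI) (auto simp: right_diff_distrib power2_eq_square)
  show "measure_pmf.expectation (bind_pmf q (conv_power \<mu>)) real = 1"
    using m q1 by (subst expectation_bind_pmf) (auto intro: integrable_real_of_square[OF I])
qed

lemma gw_law_moments:
  assumes "integrable (measure_pmf q) (\<lambda>z. real z ^ 2)" "measure_pmf.expectation q real = 1"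
  shows "integrable (gw_law q n) (\<lambda>z. real z ^ 2) \<and> measure_pmf.expectation (gw_law q n) real = 1"
  by (induction n) (use bind_conv_power_moments[OF assms] in \<open>auto simp: integrable_measure_pmf_finite\<close>)

section \<open>The discrepancy between the conditional law and its equilibrium law\<close>

text \<open>The 1-Lipschitz functions on the naturals, that is, the test class of the Wasserstein
  distance between laws of counts. The class is closed under the shifts that arise when earlier
  families are conditioned on.\<close>

definition contraction :: "(nat \<Rightarrow> real) \<Rightarrow> bool" where
  "contraction h \<longleftrightarrow> (\<forall>j k. \<bar>h j - h k\<bar> \<le> \<bar>real j - real k\<bar>)"

lemma contractionD: "contraction h \<Longrightarrow> \<bar>h j - h k\<bar> \<le> \<bar>real j - real k\<bar>"
  by (simp add: contraction_def)

lemma contraction_shift: "contraction h \<Longrightarrow> contraction (\<lambda>k. h (s + k))"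
  unfolding contraction_def by (metis (no_types, lifting) add_diff_cancel_left of_nat_add)

lemma contraction_shift_diff: "contraction h \<Longrightarrow> \<bar>h k - h (s + k)\<bar> \<le> real s"
  using contractionD[of h k "s + k"] by simp

lemma contraction_bound: "contraction h \<Longrightarrow> \<bar>h k\<bar> \<le> \<bar>h 0\<bar> + real k"
  using contractionD[of h k 0] by simp

text \<open>If \<open>Z\<close> has law \<open>\<mu>\<close> with mean 1, then \<open>tail_sum \<mu>\<close> integrates against the law with mass
  \<open>\<P>(Z > k)\<close> at \<open>k\<close>, the discrete equilibrium law of \<open>Z\<close> given \<open>Z > 0\<close>, while
  \<open>pos_part_sum \<mu> h\<close>, divided by \<open>\<P>(Z > 0)\<close>, is the mean of \<open>h (Z - 1)\<close> given \<open>Z > 0\<close>.\<close>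

definition tail_sum :: "nat pmf \<Rightarrow> (nat \<Rightarrow> real) \<Rightarrow> real" where
  "tail_sum \<mu> h = measure_pmf.expectation \<mu> (\<lambda>z. \<Sum>k<z. h k)"

text \<open>Subtracting one aligns the conditional law, supported on \<open>z \<ge> 1\<close>, with
  the equilibrium law, which starts at 0. The value 0 at \<open>z = 0\<close> discards the extinct
  paths, so that no conditional law has to be formed.\<close>

definition shifted :: "(nat \<Rightarrow> real) \<Rightarrow> nat \<Rightarrow> real" where
  "shifted h z = (if z = 0 then 0 else h (z - 1))"

definition pos_part_sum :: "nat pmf \<Rightarrow> (nat \<Rightarrow> real) \<Rightarrow> real" where
  "pos_part_sum \<mu> h = measure_pmf.expectation \<mu> (shifted h)"

lemma sum_contraction_bound:
  assumes "contraction h"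
  shows "\<bar>\<Sum>k<z. h k\<bar> \<le> (\<bar>h 0\<bar> + 1) * (1 + real z ^ 2)"
proof -
  have "\<bar>\<Sum>k<z. h k\<bar> \<le> (\<Sum>k<z. \<bar>h 0\<bar> + real z)"
  proof (rule order_trans[OF sum_abs sum_mono])
    show "\<bar>h k\<bar> \<le> \<bar>h 0\<bar> + real z" if "k \<in> {..<z}" for k
      using contraction_bound[OF assms, of k] that by simp
  qed
  also have "\<dots> = \<bar>h 0\<bar> * real z + real z ^ 2"
    by (simp add: power2_eq_square algebra_simps)
  also have "\<dots> \<le> \<bar>h 0\<bar> * (1 + real z ^ 2) + (1 + real z ^ 2)"
    using le_one_plus_square[of z] by (intro add_mono mult_left_mono) auto
  finally show ?thesis by (simp add: algebra_simps)
qed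

lemma shifted_contraction_bound:
  "contraction h \<Longrightarrow> \<bar>shifted h z\<bar> \<le> \<bar>h 0\<bar> + real z"
  using contraction_bound[of h "z - 1"] by (auto simp: shifted_def)

lemma sum_lessThan_add:
  fixes s z :: nat
  shows "(\<Sum>k<s + z. f k) = (\<Sum>k<s. f k) + (\<Sum>k<z. f (s + k) :: real)"
  by (induction z) (auto simp: algebra_simps)

lemma pmf_bind_conv_power_0:
  "pmf (bind_pmf q (conv_power \<mu>)) 0 = measure_pmf.expectation q (\<lambda>k. pmf \<mu> 0 ^ k)"
proof -
  have "pmf (conv_power \<mu> k) 0 = pmf \<mu> 0 ^ k" for k
  proof (induction k)
    case (Suc k)
    have "pmf (map_pmf ((+) s) \<mu>) 0 = pmf \<mu> 0 * indicator {0} s" for s :: nat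
    proof -
      have "(+) s -` {0} = (if s = 0 then {0} else {})" by auto
      then show ?thesis by (auto simp: pmf_map measure_pmf_single)
    qed
    then show ?case using Suc by (simp add: pmf_bind measure_pmf_single)
  qed simp
  then show ?thesis by (simp add: pmf_bind)
qed

context
  fixes \<mu> :: "nat pmf" and h :: "nat \<Rightarrow> real"
  assumes sq: "integrable (measure_pmf \<mu>) (\<lambda>z. real z ^ 2)"
    and mean: "measure_pmf.expectation \<mu> real = 1"
    and h: "contraction h"
begin

lemma integrable_sum_contraction: "integrable \<mu> (\<lambda>z. \<Sum>k<z. h k)"
  by (rule integrable_quadratic_growth[OF sq sum_contraction_bound[OF h]])

lemma integrable_shifted_contraction: "integrable \<mu> (shifted h)"
  by (rule integrable_linear_growth[OF sq shifted_contraction_bound[OF h]])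

text \<open>The Lipschitz constant is the total mass of the measure behind the functional. Here the
  mass is the mean of \<open>\<mu>\<close>, hence 1; for \<open>pos_part_sum\<close> below it is the
  survival probability, and becomes 1 after normalisation.\<close>

lemma tail_sum_lipschitz:
  assumes h': "contraction h'" and d: "\<And>k. \<bar>h k - h' k\<bar> \<le> d"
  shows "\<bar>tail_sum \<mu> h - tail_sum \<mu> h'\<bar> \<le> d"
proof -
  have i': "integrable \<mu> (\<lambda>z. \<Sum>k<z. h' k)"
    by (rule integrable_quadratic_growth[OF sq sum_contraction_bound[OF h']])
  have "\<bar>tail_sum \<mu> h - tail_sum \<mu> h'\<bar> = \<bar>measure_pmf.expectation \<mu> (\<lambda>z. \<Sum>k<z. h k - h' k)\<bar>"
    using i' integrable_sum_contraction by (simp add: tail_sum_def sum_subtractf)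
  also have "\<dots> \<le> measure_pmf.expectation \<mu> (\<lambda>z. \<bar>\<Sum>k<z. h k - h' k\<bar>)"
    by (rule integral_abs_bound)
  also have "\<dots> \<le> measure_pmf.expectation \<mu> (\<lambda>z. real z * d)"
  proof (rule integral_mono)
    show "integrable \<mu> (\<lambda>z. \<bar>\<Sum>k<z. h k - h' k\<bar>)"
      using i' integrable_sum_contraction by (simp add: sum_subtractf)
    show "\<bar>\<Sum>k<z. h k - h' k\<bar> \<le> real z * d" for z
      using order_trans[OF sum_abs sum_bounded_above[of "{..<z}" "\<lambda>k. \<bar>h k - h' k\<bar>" d]] d by simp
  qed (use integrable_real_of_square[OF sq] in simp)
  finally show ?thesis using mean by simp
qed

lemma pos_part_sum_lipschitz:
  assumes h': "contraction h'" and d: "\<And>k. \<bar>h k - h' k\<bar> \<le> d"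
  shows "\<bar>pos_part_sum \<mu> h - pos_part_sum \<mu> h'\<bar> \<le> (1 - pmf \<mu> 0) * d"
proof -
  have i': "integrable \<mu> (shifted h')"
    by (rule integrable_linear_growth[OF sq shifted_contraction_bound[OF h']])
  have "\<bar>pos_part_sum \<mu> h - pos_part_sum \<mu> h'\<bar> = \<bar>measure_pmf.expectation \<mu> (\<lambda>z. shifted h z - shifted h' z)\<bar>"
    using i' integrable_shifted_contraction by (simp add: pos_part_sum_def)
  also have "\<dots> \<le> measure_pmf.expectation \<mu> (\<lambda>z. \<bar>shifted h z - shifted h' z\<bar>)"
    by (rule integral_abs_bound)
  also have "\<dots> \<le> measure_pmf.expectation \<mu> (\<lambda>z. indicator (- {0}) z * d)"
  proof (rule integral_mono)
    show "integrable \<mu> (\<lambda>z. \<bar>shifted h z - shifted h' z\<bar>)"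
      using i' integrable_shifted_contraction by simp
    show "\<bar>shifted h z - shifted h' z\<bar> \<le> indicator (- {0}) z * d" for z
      using d by (auto simp: shifted_def)
  qed (simp add: integrable_pmf_indicator)
  also have "\<dots> = (1 - pmf \<mu> 0) * d"
    using measure_pmf.prob_compl[of "{0}" \<mu>] by (simp add: measure_pmf_single Compl_eq_Diff_UNIV)
  finally show ?thesis .
qed

lemma integrable_tail_sum_shift:
  "integrable (conv_power \<mu> i) (\<lambda>s. tail_sum \<mu> (\<lambda>k. h (s + k)))"
proof (rule integrable_linear_growth)
  show "integrable (conv_power \<mu> i) (\<lambda>z. real z ^ 2)"
    using conv_power_moments[OF sq mean] by blast
  show "\<bar>tail_sum \<mu> (\<lambda>k. h (s + k))\<bar> \<le> \<bar>tail_sum \<mu> h\<bar> + real s" for s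
    using tail_sum_lipschitz[OF contraction_shift[OF h, of s] contraction_shift_diff[OF h]] by simp
qed

lemma integrable_pos_part_sum_shift:
  "integrable (conv_power \<mu> i) (\<lambda>s. pos_part_sum \<mu> (\<lambda>k. h (s + k)))"
proof (rule integrable_linear_growth)
  show "integrable (conv_power \<mu> i) (\<lambda>z. real z ^ 2)"
    using conv_power_moments[OF sq mean] by blast
  fix s
  have "\<bar>pos_part_sum \<mu> h - pos_part_sum \<mu> (\<lambda>k. h (s + k))\<bar> \<le> (1 - pmf \<mu> 0) * real s"
    by (rule pos_part_sum_lipschitz[OF contraction_shift[OF h] contraction_shift_diff[OF h]])
  also have "\<dots> \<le> real s"
    by (simp add: mult_left_le_one_le pmf_le_1)
  finally show "\<bar>pos_part_sum \<mu> (\<lambda>k. h (s + k))\<bar> \<le> \<bar>pos_part_sum \<mu> h\<bar> + real s"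
    by simp
qed

text \<open>Cut the range of summation at the partial sums of the \<open>K\<close> summands: block
  \<open>i\<close> has as its length a copy of \<open>\<mu>\<close> independent of its starting
  point \<open>s\<close>, and sees \<open>h\<close> shifted by \<open>s\<close>.\<close>

lemma tail_sum_conv_power:
  "tail_sum (conv_power \<mu> K) h
    = (\<Sum>i<K. measure_pmf.expectation (conv_power \<mu> i) (\<lambda>s. tail_sum \<mu> (\<lambda>k. h (s + k))))"
proof (induction K)
  case 0
  show ?case by (simp add: tail_sum_def)
next
  case (Suc K)
  have i: "integrable (conv_power \<mu> K) (\<lambda>z. \<Sum>k<z. h k)"
    using conv_power_moments[OF sq mean] sum_contraction_bound[OF h]
    by (blast intro: integrable_quadratic_growth)
  have "measure_pmf.expectation \<mu> (\<lambda>z. \<Sum>k<s + z. h k) = (\<Sum>k<s. h k) + tail_sum \<mu> (\<lambda>k. h (s + k))" for s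
    unfolding tail_sum_def sum_lessThan_add
    using integrable_quadratic_growth[OF sq sum_contraction_bound[OF contraction_shift[OF h]]] by simp
  then have "tail_sum (conv_power \<mu> (Suc K)) h = measure_pmf.expectation (conv_power \<mu> K)
      (\<lambda>s. (\<Sum>k<s. h k) + tail_sum \<mu> (\<lambda>k. h (s + k)))"
    using expectation_conv_power_Suc(1)[OF sq mean sum_contraction_bound[OF h], of K]
    by (simp add: tail_sum_def)
  also have "\<dots> = tail_sum (conv_power \<mu> K) h
      + measure_pmf.expectation (conv_power \<mu> K) (\<lambda>s. tail_sum \<mu> (\<lambda>k. h (s + k)))"
    using i integrable_tail_sum_shift by (simp add: tail_sum_def)
  finally show ?case using Suc by simp
qed

text \<open>The recursion splits according to whether the last of the \<open>K\<close> summands vanishes.\<close>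

lemma pos_part_sum_conv_power:
  "pos_part_sum (conv_power \<mu> K) h
    = (\<Sum>i<K. pmf \<mu> 0 ^ (K - Suc i)
        * measure_pmf.expectation (conv_power \<mu> i) (\<lambda>s. pos_part_sum \<mu> (\<lambda>k. h (s + k))))"
    (is "_ = (\<Sum>i<K. _ * ?a i)")
proof (induction K)
  case 0
  show ?case by (simp add: pos_part_sum_def shifted_def)
next
  case (Suc K)
  have i: "integrable (conv_power \<mu> K) (shifted h)"
    using conv_power_moments[OF sq mean] shifted_contraction_bound[OF h]
    by (blast intro: integrable_linear_growth)
  have "measure_pmf.expectation \<mu> (\<lambda>z. shifted h (s + z))
      = shifted h s * pmf \<mu> 0 + pos_part_sum \<mu> (\<lambda>k. h (s + k))" for s
  proof -
    \<comment> \<open>For \<open>z > 0\<close> the predecessor of \<open>s + z\<close> is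
      \<open>s + (z - 1)\<close>; for \<open>z = 0\<close> the earlier summands decide. Unfolded,
      \<open>i\<close> is the last nonzero summand, and the \<open>K - Suc i\<close> zeros after it
      produce the power of \<open>pmf \<mu> 0\<close>.\<close>
    have "(\<lambda>z. shifted h (s + z)) = (\<lambda>z. shifted h s * indicator {0} z + shifted (\<lambda>k. h (s + k)) z)"
      by (auto simp: shifted_def fun_eq_iff indicator_def)
    then show ?thesis
      unfolding pos_part_sum_def
      using integrable_linear_growth[OF sq shifted_contraction_bound[OF contraction_shift[OF h, of s]]]
      by (simp add: measure_pmf_single integrable_pmf_indicator)
  qed
  then have "pos_part_sum (conv_power \<mu> (Suc K)) h = measure_pmf.expectation (conv_power \<mu> K)
      (\<lambda>s. shifted h s * pmf \<mu> 0 + pos_part_sum \<mu> (\<lambda>k. h (s + k)))"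
    using expectation_conv_power_Suc(1)[OF sq mean
        linear_le_quadratic[OF shifted_contraction_bound[OF h]], of K]
    by (simp add: pos_part_sum_def)
  also have "\<dots> = pos_part_sum (conv_power \<mu> K) h * pmf \<mu> 0 + ?a K"
    using i integrable_pos_part_sum_shift by (simp add: pos_part_sum_def)
  also have "pos_part_sum (conv_power \<mu> K) h * pmf \<mu> 0 = (\<Sum>i<K. pmf \<mu> 0 ^ (Suc K - Suc i) * ?a i)"
    unfolding Suc sum_distrib_right by (intro sum.cong) (simp_all add: Suc_diff_Suc mult_ac flip: power_Suc)
  finally show ?case by simp
qed

end

text \<open>Condition on the size \<open>K\<close> of the first generation and split the sum of its \<open>K\<close> independent
  families family by family. Both functionals become weighted sums over \<open>i < K\<close> of their versions for
  \<open>\<mu>\<close>; the weights differ by \<open>O(p)\<close> and have the same total mass, so \<open>h\<close> may be recentred, which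
  costs one further factor \<open>i\<close> and is where the third moment enters.\<close>

lemma yaglom_discrepancy_step:
  fixes q \<mu> :: "nat pmf"
  defines "\<nu> \<equiv> bind_pmf q (conv_power \<mu>)"
  defines "p \<equiv> 1 - pmf \<mu> 0" and "p' \<equiv> 1 - pmf \<nu> 0"
  assumes q3: "integrable (measure_pmf q) (\<lambda>z. real z ^ 3)"
    and q1: "measure_pmf.expectation q real = 1"
    and sq: "integrable (measure_pmf \<mu>) (\<lambda>z. real z ^ 2)"
    and mean: "measure_pmf.expectation \<mu> real = 1"
    and p: "0 < p'" "p' \<le> p"
    and w: "\<And>h. contraction h \<Longrightarrow> \<bar>pos_part_sum \<mu> h / p - tail_sum \<mu> h\<bar> \<le> w"
    and h: "contraction h"
  shows "\<bar>pos_part_sum \<nu> h / p' - tail_sum \<nu> h\<bar>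
    \<le> w + (p / p' - 1) * measure_pmf.expectation q (\<lambda>k. real k ^ 2)
        + p * measure_pmf.expectation q (\<lambda>k. real k ^ 3)"
proof -
  note q2 = integrable_lower_power[OF q3]
  note qint = integrable_real_of_square[OF q2]
  have \<nu>2: "integrable \<nu> (\<lambda>z. real z ^ 2)" and \<nu>1: "measure_pmf.expectation \<nu> real = 1"
    unfolding \<nu>_def by (rule bind_conv_power_moments[OF q2 q1 sq mean])+
  have p0: "0 < p" and x: "pmf \<mu> 0 = 1 - p" and p1: "p \<le> 1" using p by (auto simp: p_def)
  define r where "r = p / p'"
  have r: "1 \<le> r" using p by (simp add: r_def)
  \<comment> \<open>\<open>a i\<close> belongs to family \<open>i\<close> given that it is nonempty,
    \<open>b i\<close> to its equilibrium law, both displaced by the earlier families. Given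
    \<open>K\<close> families their weights are \<open>r * (1 - p) ^ (K - Suc i)\<close> and 1, and
    \<open>c K\<close> is the difference of the total weights.\<close>
  define a where "a i = measure_pmf.expectation (conv_power \<mu> i) (\<lambda>s. pos_part_sum \<mu> (\<lambda>k. h (s + k))) / p" for i
  define b where "b i = measure_pmf.expectation (conv_power \<mu> i) (\<lambda>s. tail_sum \<mu> (\<lambda>k. h (s + k)))" for i
  define c where "c K = (1 - (1 - p) ^ K) / p' - real K" for K
  have c: "c K = (\<Sum>i<K. r * (1 - p) ^ (K - Suc i) - 1)" for K
    by (simp add: c_def sum_subtractf one_diff_power_eq'[of "1 - p"] r_def sum_distrib_left sum_divide_distrib)
  have pow: "integrable q (\<lambda>k. (1 - p) ^ k)"
    using p0 p1 by (intro measure_pmf.integrable_const_bound[where B = 1]) (auto simp: power_le_one)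
  have p'_eq: "measure_pmf.expectation q (\<lambda>k. (1 - p) ^ k) = 1 - p'"
    unfolding p'_def \<nu>_def by (simp add: pmf_bind_conv_power_0 x)
  \<comment> \<open>Centred, since \<open>1 - (1 - p) ^ K\<close> has mean \<open>p'\<close> and
    \<open>K\<close> has mean 1. Hence \<open>a 0 * c K\<close> can be subtracted below without
    changing the expectation.\<close>
  have ci: "integrable q c" and Ec: "measure_pmf.expectation q c = 0"
    unfolding c_def using pow qint q1 p by (auto simp: p'_eq)
  have ab: "\<bar>a i - b i\<bar> \<le> w" for i
  proof -
    have "a i - b i = measure_pmf.expectation (conv_power \<mu> i)
        (\<lambda>s. pos_part_sum \<mu> (\<lambda>k. h (s + k)) / p - tail_sum \<mu> (\<lambda>k. h (s + k)))"
      unfolding a_def b_def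
      using integrable_tail_sum_shift[OF sq mean h] integrable_pos_part_sum_shift[OF sq mean h] by simp
    also have "\<bar>\<dots>\<bar> \<le> w"
      by (rule expectation_abs_le_const) (rule w[OF contraction_shift[OF h]])
    finally show ?thesis .
  qed
  have a0: "a 0 = pos_part_sum \<mu> h / p"
    by (simp add: a_def)
  have aa: "\<bar>a i - a 0\<bar> \<le> real i" for i
  proof -
    have m: "integrable (conv_power \<mu> i) real" "measure_pmf.expectation (conv_power \<mu> i) real = real i"
      using conv_power_moments[OF sq mean, of i] integrable_real_of_square by auto
    note int = integrable_pos_part_sum_shift[OF sq mean h, of i]
    have "a i - a 0 = measure_pmf.expectation (conv_power \<mu> i)
        (\<lambda>s. (pos_part_sum \<mu> (\<lambda>k. h (s + k)) - pos_part_sum \<mu> h) / p)"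
      unfolding a0 using int by (simp add: a_def diff_divide_distrib)
    also have "\<bar>\<dots>\<bar> \<le> measure_pmf.expectation (conv_power \<mu> i)
        (\<lambda>s. \<bar>(pos_part_sum \<mu> (\<lambda>k. h (s + k)) - pos_part_sum \<mu> h) / p\<bar>)"
      by (rule integral_abs_bound)
    also have "\<dots> \<le> measure_pmf.expectation (conv_power \<mu> i) real"
    proof (rule integral_mono)
      show "\<bar>(pos_part_sum \<mu> (\<lambda>k. h (s + k)) - pos_part_sum \<mu> h) / p\<bar> \<le> real s" for s
        using pos_part_sum_lipschitz[OF sq mean h contraction_shift[OF h] contraction_shift_diff[OF h], of s] p0
        by (simp add: p_def field_simps abs_minus_commute)
    qed (use int m in auto)
    finally show ?thesis using m by simp
  qed
  have D: "\<bar>pos_part_sum (conv_power \<mu> K) h / p' - tail_sum (conv_power \<mu> K) h - a 0 * c K\<bar>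
      \<le> real K * w + (r - 1) * real K ^ 2 + p * real K ^ 3" for K
  proof -
    have "pos_part_sum (conv_power \<mu> K) h / p' = (\<Sum>i<K. r * (1 - p) ^ (K - Suc i) * a i)"
      unfolding pos_part_sum_conv_power[OF sq mean h] sum_divide_distrib
      using p0 p by (intro sum.cong) (auto simp: r_def a_def x)
    \<comment> \<open>After recentring, the difference of the weights multiplies
      \<open>a i - a 0\<close>, which is at most \<open>i\<close> because the displacement has mean
      \<open>i\<close>. Without it the factor \<open>a i\<close> would depend on the size of
      \<open>h\<close>.\<close>
    then have "pos_part_sum (conv_power \<mu> K) h / p' - tail_sum (conv_power \<mu> K) h - a 0 * c K
      = (\<Sum>i<K. (a i - b i) + (r * (1 - p) ^ (K - Suc i) - 1) * (a i - a 0))"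
      unfolding tail_sum_conv_power[OF sq mean h] c b_def[symmetric]
      by (simp add: sum_distrib_left algebra_simps flip: sum.distrib sum_subtractf)
    also have "\<bar>\<dots>\<bar> \<le> (\<Sum>i<K. w + ((r - 1) + real K * p) * real K)"
    proof (rule order_trans[OF sum_abs sum_mono])
      fix i assume i: "i \<in> {..<K}"
      let ?x = "(1 - p) ^ (K - Suc i)"
      \<comment> \<open>The weight lies between \<open>1 - K * p\<close>, by Bernoulli and
        \<open>r \<ge> 1\<close>, and \<open>r\<close>.\<close>
      have "1 - real (K - Suc i) * p \<le> ?x"
        using Bernoulli_inequality[of "- p" "K - Suc i"] p1 by simp
      moreover have "real (K - Suc i) * p \<le> real K * p"
        using p0 by (intro mult_right_mono) auto
      moreover have "?x \<le> r * ?x" "r * ?x \<le> r"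
        using r p0 p1 by (auto simp: mult_le_cancel_right1 mult_le_cancel_left2 power_le_one)
      moreover have "0 \<le> real K * p" using p0 by simp
      ultimately have "\<bar>r * ?x - 1\<bar> \<le> (r - 1) + real K * p"
        using r by linarith
      then have "\<bar>r * ?x - 1\<bar> * \<bar>a i - a 0\<bar> \<le> ((r - 1) + real K * p) * real K"
        using aa[of i] i r p0 by (intro mult_mono) auto
      then show "\<bar>(a i - b i) + (r * ?x - 1) * (a i - a 0)\<bar> \<le> w + ((r - 1) + real K * p) * real K"
        using ab[of i] by (simp add: abs_mult[symmetric])
    qed
    also have "\<dots> = real K * w + (r - 1) * real K ^ 2 + p * real K ^ 3"
      by (simp add: power2_eq_square power3_eq_cube algebra_simps)
    finally show ?thesis .
  qed
  have i1: "integrable \<nu> (shifted h)"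
    by (rule integrable_shifted_contraction[OF \<nu>2 \<nu>1 h])
  have i2: "integrable \<nu> (\<lambda>z. \<Sum>k<z. h k)"
    by (rule integrable_sum_contraction[OF \<nu>2 \<nu>1 h])
  have E1: "integrable q (\<lambda>K. pos_part_sum (conv_power \<mu> K) h)"
    "pos_part_sum \<nu> h = measure_pmf.expectation q (\<lambda>K. pos_part_sum (conv_power \<mu> K) h)"
    using integrable_bind_pmfD expectation_bind_pmf i1 unfolding \<nu>_def pos_part_sum_def by blast+
  have E2: "integrable q (\<lambda>K. tail_sum (conv_power \<mu> K) h)"
    "tail_sum \<nu> h = measure_pmf.expectation q (\<lambda>K. tail_sum (conv_power \<mu> K) h)"
    using integrable_bind_pmfD expectation_bind_pmf i2 unfolding \<nu>_def tail_sum_def by blast+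
  have "pos_part_sum \<nu> h / p' - tail_sum \<nu> h = measure_pmf.expectation q
      (\<lambda>K. pos_part_sum (conv_power \<mu> K) h / p' - tail_sum (conv_power \<mu> K) h - a 0 * c K)"
    using E1 E2 ci Ec by simp
  also have "\<bar>\<dots>\<bar> \<le> measure_pmf.expectation q
      (\<lambda>K. \<bar>pos_part_sum (conv_power \<mu> K) h / p' - tail_sum (conv_power \<mu> K) h - a 0 * c K\<bar>)"
    by (rule integral_abs_bound)
  also have "\<dots> \<le> measure_pmf.expectation q (\<lambda>K. real K * w + (r - 1) * real K ^ 2 + p * real K ^ 3)"
    using E1 E2 ci qint q2 q3 D by (intro integral_mono) auto
  also have "\<dots> = w + (r - 1) * measure_pmf.expectation q (\<lambda>k. real k ^ 2)
        + p * measure_pmf.expectation q (\<lambda>k. real k ^ 3)"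
    using qint q2 q3 q1 by simp
  finally show ?thesis unfolding r_def .
qed

section \<open>Survival probability\<close>

text \<open>Each of the four bounds on \<open>(1 - p) ^ k\<close> is integrated against
  \<open>q\<close> later and turns into an inequality between consecutive survival probabilities;
  upper bounds here become lower bounds there.\<close>

lemma one_minus_power_upper1:
  fixes p :: real assumes "0 \<le> p" "p \<le> 1"
  shows "(1 - p) ^ k \<le> 1 - p * indicator (- {0}) k"
  using power_decreasing[of 1 k "1 - p"] assms by (cases k) (auto simp: mult_left_le_one_le power_le_one mult_left_le)

lemma one_minus_power_upper2:
  fixes p :: real assumes "0 \<le> p" "p \<le> 1"
  shows "(1 - p) ^ k \<le> 1 - real k * p + (real k ^ 2 - real k) / 2 * p ^ 2"
proof (induction k)
  case (Suc k)
  have "(1 - p) ^ Suc k \<le> (1 - p) * (1 - real k * p + (real k ^ 2 - real k) / 2 * p ^ 2)"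
    using Suc assms by (simp add: mult_left_mono)
  also have "\<dots> = 1 - real (Suc k) * p + (real (Suc k) ^ 2 - real (Suc k)) / 2 * p ^ 2
      - (real k ^ 2 - real k) / 2 * p ^ 3"
    by (simp add: power2_eq_square power3_eq_cube field_simps)
  also have "\<dots> \<le> 1 - real (Suc k) * p + (real (Suc k) ^ 2 - real (Suc k)) / 2 * p ^ 2"
    using assms by (cases k) (auto simp: power2_eq_square)
  finally show ?case .
qed simp

text \<open>The coefficient of \<open>p ^ 2\<close> is chosen for its mean, which is
  \<open>pmf q 0\<close> when \<open>q\<close> has mean 1. There is no cubic error, so the resulting
  decrease of the survival probability holds at every time.\<close>

lemma one_minus_power_lower1:
  fixes p :: real assumes "0 \<le> p" "p \<le> 1"
  shows "1 - real k * p + (real k - 1 + indicator {0} k) * p ^ 2 \<le> (1 - p) ^ k"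
proof (induction k)
  case (Suc k)
  have "1 - real (Suc k) * p + (real (Suc k) - 1 + indicator {0} (Suc k)) * p ^ 2
      = 1 - real k * p - p + real k * p ^ 2" by (simp add: algebra_simps)
  also have "\<dots> \<le> (1 - p) * (1 - real k * p + (real k - 1 + indicator {0} k) * p ^ 2)"
  proof (cases k)
    case (Suc j)
    have "0 \<le> (1 - p) * (real j * p ^ 2)" using assms by simp
    then show ?thesis using Suc by (simp add: algebra_simps power2_eq_square)
  qed auto
  also have "\<dots> \<le> (1 - p) ^ Suc k"
    using Suc assms by (simp add: mult_left_mono)
  finally show ?case .
qed simp

text \<open>Agrees with \<open>one_minus_power_upper2\<close> up to a cubic term. The factor
  \<open>k ^ 3\<close> is far above the binomial coefficient; with it all terms left over in the
  induction step are nonnegative.\<close>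

lemma one_minus_power_lower2:
  fixes p :: real assumes "0 \<le> p" "p \<le> 1"
  shows "1 - real k * p + (real k ^ 2 - real k) / 2 * p ^ 2 - real k ^ 3 * p ^ 3 \<le> (1 - p) ^ k"
proof (induction k)
  case (Suc k)
  have "0 \<le> (2 * real k ^ 2 + 3 * real k + 1 + real k ^ 2 / 2 + real k / 2) * p ^ 3 + real k ^ 3 * p ^ 4"
    using assms by (intro add_nonneg_nonneg mult_nonneg_nonneg) auto
  also have "\<dots> = (1 - p) * (1 - real k * p + (real k ^ 2 - real k) / 2 * p ^ 2 - real k ^ 3 * p ^ 3)
      - (1 - real (Suc k) * p + (real (Suc k) ^ 2 - real (Suc k)) / 2 * p ^ 2 - real (Suc k) ^ 3 * p ^ 3)"
    by (simp add: power2_eq_square power3_eq_cube power4_eq_xxxx field_simps)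
  also have "\<dots> \<le> (1 - p) ^ Suc k
      - (1 - real (Suc k) * p + (real (Suc k) ^ 2 - real (Suc k)) / 2 * p ^ 2 - real (Suc k) ^ 3 * p ^ 3)"
    using Suc assms by (simp add: mult_left_mono del: of_nat_Suc)
  finally show ?case by simp
qed simp

section \<open>Recursive inequalities for the survival probability\<close>

definition gw_survival :: "nat pmf \<Rightarrow> nat \<Rightarrow> real" where
  "gw_survival q n = 1 - pmf (gw_law q n) 0"

lemma gw_survival_0: "gw_survival q 0 = 1"
  by (simp add: gw_survival_def)

lemma gw_survival_Suc:
  "gw_survival q (Suc n) = 1 - measure_pmf.expectation q (\<lambda>k. (1 - gw_survival q n) ^ k)"
  by (simp add: gw_survival_def pmf_bind_conv_power_0)

lemma gw_survival_bounds: "0 \<le> gw_survival q n" "gw_survival q n \<le> 1"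
  by (auto simp: gw_survival_def pmf_le_1)

lemma integrable_power_one_minus: "integrable (measure_pmf q) (\<lambda>k. (1 - gw_survival q n) ^ k)"
  using gw_survival_bounds by (intro measure_pmf.integrable_const_bound[where B = 1]) (auto simp: power_le_one)

text \<open>For mean 1 this is half the variance, equivalently the mean of
  \<open>k * (k - 1) / 2\<close>: the quadratic coefficient in the recursion for survival and the
  asymptotic slope of its reciprocal.\<close>

definition half_var :: "nat pmf \<Rightarrow> real" where
  "half_var q = (measure_pmf.expectation q (\<lambda>k. real k ^ 2) - 1) / 2"

context
  fixes q :: "nat pmf"
  assumes q3: "integrable (measure_pmf q) (\<lambda>z. real z ^ 3)"
    and q1: "measure_pmf.expectation q real = 1"
    and q0: "0 < pmf q 0" and pmf_0_lt_1: "pmf q 0 < 1"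
begin

lemma offspring_square: "integrable q (\<lambda>z. real z ^ 2)"
  by (rule integrable_lower_power[OF q3])

text \<open>In terms of the process: it suffices that the ancestor has a child and that the first
  child has descendants \<open>n\<close> generations later.\<close>

lemma gw_survival_Suc_ge1: "gw_survival q (Suc n) \<ge> (1 - pmf q 0) * gw_survival q n"
proof -
  let ?p = "gw_survival q n"
  have "measure_pmf.expectation q (\<lambda>k. (1 - ?p) ^ k) \<le> measure_pmf.expectation q (\<lambda>k. 1 - ?p * indicator (- {0}) k)"
    using one_minus_power_upper1[OF gw_survival_bounds] integrable_power_one_minus
    by (intro integral_mono) (auto simp: integrable_pmf_indicator)
  also have "\<dots> = 1 - ?p * (1 - pmf q 0)"
    using measure_pmf.prob_compl[of "{0}" q]
    by (simp add: measure_pmf_single Compl_eq_Diff_UNIV integrable_pmf_indicator)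
  finally show ?thesis by (simp add: gw_survival_Suc mult.commute)
qed

lemma gw_survival_pos: "0 < gw_survival q n"
proof (induction n)
  case (Suc n)
  have "0 < (1 - pmf q 0) * gw_survival q n" using Suc pmf_0_lt_1 by simp
  then show ?case using gw_survival_Suc_ge1[of n] by linarith
qed (simp add: gw_survival_0)

lemma half_var_nonneg: "0 \<le> half_var q"
proof -
  have "real k \<le> real k ^ 2" for k by (cases k) (auto simp: power2_eq_square)
  then have "measure_pmf.expectation q real \<le> measure_pmf.expectation q (\<lambda>k. real k ^ 2)"
    using offspring_square integrable_real_of_square by (intro integral_mono) auto
  then show ?thesis using q1 by (simp add: half_var_def)
qed

lemma gw_survival_Suc_ge2: "gw_survival q (Suc n) \<ge> gw_survival q n - half_var q * gw_survival q n ^ 2"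
proof -
  let ?p = "gw_survival q n"
  note int = integrable_real_of_square[OF offspring_square] offspring_square
  have "measure_pmf.expectation q (\<lambda>k. (1 - ?p) ^ k)
      \<le> measure_pmf.expectation q (\<lambda>k. 1 - real k * ?p + (real k ^ 2 - real k) / 2 * ?p ^ 2)"
    using one_minus_power_upper2[OF gw_survival_bounds] integrable_power_one_minus int
    by (intro integral_mono) auto
  also have "\<dots> = 1 - ?p + half_var q * ?p ^ 2"
    using int q1 by (simp add: half_var_def)
  finally show ?thesis by (simp add: gw_survival_Suc)
qed

lemma gw_survival_Suc_le2: "gw_survival q (Suc n) \<le> gw_survival q n - half_var q * gw_survival q n ^ 2
    + measure_pmf.expectation q (\<lambda>k. real k ^ 3) * gw_survival q n ^ 3"
proof -
  let ?p = "gw_survival q n"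
  note int = integrable_real_of_square[OF offspring_square] offspring_square q3
  have "1 - ?p + half_var q * ?p ^ 2 - measure_pmf.expectation q (\<lambda>k. real k ^ 3) * ?p ^ 3 =
      measure_pmf.expectation q (\<lambda>k. 1 - real k * ?p + (real k ^ 2 - real k) / 2 * ?p ^ 2 - real k ^ 3 * ?p ^ 3)"
    using int q1 by (simp add: half_var_def)
  also have "\<dots> \<le> measure_pmf.expectation q (\<lambda>k. (1 - ?p) ^ k)"
    using one_minus_power_lower2[OF gw_survival_bounds] integrable_power_one_minus int
    by (intro integral_mono) auto
  finally show ?thesis by (simp add: gw_survival_Suc)
qed

lemma gw_survival_Suc_le1: "gw_survival q (Suc n) \<le> gw_survival q n - pmf q 0 * gw_survival q n ^ 2"
proof -
  let ?p = "gw_survival q n"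
  note int = integrable_real_of_square[OF offspring_square]
  have "1 - ?p + pmf q 0 * ?p ^ 2 =
      measure_pmf.expectation q (\<lambda>k. 1 - real k * ?p + (real k - 1 + indicator {0} k) * ?p ^ 2)"
    using int q1 by (simp add: integrable_pmf_indicator measure_pmf_single)
  also have "\<dots> \<le> measure_pmf.expectation q (\<lambda>k. (1 - ?p) ^ k)"
    using one_minus_power_lower1[OF gw_survival_bounds] integrable_power_one_minus int
    by (intro integral_mono) (auto simp: integrable_pmf_indicator)
  finally show ?thesis by (simp add: gw_survival_Suc)
qed

lemma gw_survival_Suc_le: "gw_survival q (Suc n) \<le> gw_survival q n"
proof -
  have "0 \<le> pmf q 0 * gw_survival q n ^ 2" by simp
  then show ?thesis using gw_survival_Suc_le1[of n] by linarith
qed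

text \<open>Passing to the reciprocal turns a quadratic decrease into a constant increment, which
  sums to linear growth.\<close>

lemma inverse_gw_survival_Suc_ge:
  "1 / gw_survival q n + pmf q 0 \<le> 1 / gw_survival q (Suc n)"
proof -
  let ?p = "gw_survival q n" and ?p' = "gw_survival q (Suc n)"
  have "pmf q 0 * (?p * ?p') \<le> pmf q 0 * (?p * ?p)"
    using gw_survival_Suc_le gw_survival_bounds by (intro mult_left_mono) auto
  then have "pmf q 0 * (?p * ?p') \<le> ?p - ?p'"
    using gw_survival_Suc_le1[of n] by (simp add: power2_eq_square)
  then show ?thesis
    using gw_survival_pos[of n] gw_survival_pos[of "Suc n"] by (simp add: field_simps)
qed

lemma inverse_gw_survival_ge: "1 + pmf q 0 * real n \<le> 1 / gw_survival q n"
proof (induction n)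
  case (Suc n)
  then show ?case using inverse_gw_survival_Suc_ge[of n] by (simp add: algebra_simps)
qed (simp add: gw_survival_0)

lemma gw_survival_le: "n \<ge> 1 \<Longrightarrow> gw_survival q n \<le> 1 / (pmf q 0 * real n)"
proof -
  assume n: "n \<ge> 1"
  have "pmf q 0 * real n \<le> 1 / gw_survival q n"
    using inverse_gw_survival_ge[of n] by linarith
  then show ?thesis
    using n q0 gw_survival_pos[of n] by (simp add: field_simps)
qed

lemma sum_gw_survival_le_harm: "(\<Sum>j<Suc n. gw_survival q j) \<le> 1 + harm n / pmf q 0"
proof (induction n)
  case (Suc n)
  have "gw_survival q (Suc n) \<le> inverse (of_nat (Suc n)) / pmf q 0"
    using gw_survival_le[of "Suc n"] by (simp add: divide_inverse mult.commute)
  then show ?case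
    using Suc unfolding sum.lessThan_Suc[of _ "Suc n"] harm_Suc add_divide_distrib by linarith
qed (simp add: gw_survival_0 harm_def)

lemma sum_gw_survival_le_ln:
  assumes "n \<ge> 2"
  shows "(\<Sum>j<n. gw_survival q j) \<le> (2 + 3 / pmf q 0) * ln (real n)"
proof -
  have "harm n - ln (real n) \<le> harm 1 - ln (real 1)"
    by (rule euler_mascheroni_sequence_decreasing) (use assms in auto)
  then have harm: "harm n \<le> 1 + ln (real n)" by (simp add: harm_def)
  have "ln 2 \<le> ln (real n)" using assms by simp
  \<comment> \<open>From \<open>n \<ge> 2\<close> on, additive constants are absorbed:
    \<open>1 \<le> 2 * ln n\<close> and \<open>1 + ln n \<le> 3 * ln n\<close>, whence the 2 and the
    3.\<close>
  then have ln: "1 / 2 \<le> ln (real n)" using ln2_ge_two_thirds by linarith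
  have "(\<Sum>j<n. gw_survival q j) \<le> (\<Sum>j<Suc n. gw_survival q j)"
    using gw_survival_bounds by simp
  also have "\<dots> \<le> 1 + (1 + ln (real n)) / pmf q 0"
    using sum_gw_survival_le_harm[of n] harm q0 by (smt (verit) divide_right_mono)
  also have "\<dots> \<le> 2 * ln (real n) + 3 * ln (real n) / pmf q 0"
    using ln q0 by (intro add_mono divide_right_mono) auto
  finally show ?thesis by (simp add: algebra_simps)
qed

text \<open>The drop is at most quadratic in \<open>p\<close>. The denominator is bounded by
  \<open>gw_survival_Suc_ge1\<close>, since the quadratic lower bound can be negative when
  \<open>half_var q\<close> is large.\<close>

lemma gw_survival_ratio:
  "gw_survival q n / gw_survival q (Suc n) - 1 \<le> half_var q / (1 - pmf q 0) * gw_survival q n"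
proof -
  let ?p = "gw_survival q n" and ?p' = "gw_survival q (Suc n)"
  have "?p / ?p' - 1 = (?p - ?p') / ?p'"
    using gw_survival_pos[of "Suc n"] by (simp add: diff_divide_distrib)
  also have "\<dots> \<le> (half_var q * ?p ^ 2) / ((1 - pmf q 0) * ?p)"
    using gw_survival_Suc_ge2[of n] gw_survival_Suc_ge1[of n] gw_survival_pos[of n] pmf_0_lt_1
      half_var_nonneg by (intro frac_le) auto
  also have "\<dots> = half_var q / (1 - pmf q 0) * ?p"
    using gw_survival_pos[of n] by (simp add: power2_eq_square)
  finally show ?thesis .
qed

text \<open>The increment is \<open>(p - p') / (p * p')\<close>, with numerator
  \<open>half_var q * p ^ 2\<close> up to a cubic error. Replacing \<open>p * p'\<close> by
  \<open>p ^ 2\<close> costs the ratio bound, again \<open>O(p)\<close>.\<close>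

lemma inverse_gw_survival_increment:
  "\<bar>1 / gw_survival q (Suc n) - 1 / gw_survival q n - half_var q\<bar>
   \<le> (half_var q ^ 2 + measure_pmf.expectation q (\<lambda>k. real k ^ 3)) / (1 - pmf q 0) * gw_survival q n"
proof -
  let ?p = "gw_survival q n" and ?p' = "gw_survival q (Suc n)"
    and ?T = "measure_pmf.expectation q (\<lambda>k. real k ^ 3)"
  have pos: "0 < ?p" "0 < ?p'" "0 < 1 - pmf q 0"
    using gw_survival_pos pmf_0_lt_1 by auto
  have T: "0 \<le> ?T" by simp
  have r: "1 \<le> ?p / ?p'" using pos gw_survival_Suc_le by simp
  have eq: "1 / ?p' - 1 / ?p = (?p - ?p') / (?p * ?p')" using pos by (simp add: field_simps)
  have "(?p - ?p') / (?p * ?p') \<le> (half_var q * ?p ^ 2) / (?p * ?p')"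
    using gw_survival_Suc_ge2[of n] pos by (intro divide_right_mono) auto
  also have "\<dots> = half_var q * (?p / ?p')" using pos by (simp add: power2_eq_square)
  finally have "1 / ?p' - 1 / ?p - half_var q \<le> half_var q * (?p / ?p' - 1)"
    by (simp add: eq algebra_simps)
  also have "\<dots> \<le> half_var q * (half_var q / (1 - pmf q 0) * ?p)"
    by (rule mult_left_mono[OF gw_survival_ratio half_var_nonneg])
  also have "\<dots> \<le> (half_var q ^ 2 + ?T) / (1 - pmf q 0) * ?p"
    using T pos by (simp add: power2_eq_square add_divide_distrib distrib_right mult.assoc)
  finally have upper: "1 / ?p' - 1 / ?p - half_var q \<le> (half_var q ^ 2 + ?T) / (1 - pmf q 0) * ?p" .
  have "half_var q * ?p ^ 2 - ?T * ?p ^ 3 \<le> ?p - ?p'"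
    using gw_survival_Suc_le2[of n] by linarith
  then have "(half_var q * ?p ^ 2 - ?T * ?p ^ 3) / (?p * ?p') \<le> (?p - ?p') / (?p * ?p')"
    using pos by (intro divide_right_mono) auto
  moreover have "(half_var q * ?p ^ 2 - ?T * ?p ^ 3) / (?p * ?p') = half_var q * (?p / ?p') - ?T * ?p * (?p / ?p')"
    using pos by (simp add: power2_eq_square power3_eq_cube diff_divide_distrib)
  moreover have "half_var q * 1 \<le> half_var q * (?p / ?p')"
    by (rule mult_left_mono[OF r half_var_nonneg])
  ultimately have "- (?T * ?p * (?p / ?p')) \<le> 1 / ?p' - 1 / ?p - half_var q"
    unfolding eq by linarith
  moreover have "?T * ?p * (?p / ?p') \<le> ?T * ?p * (1 / (1 - pmf q 0))"
    using gw_survival_Suc_ge1[of n] T pos by (intro mult_left_mono) (auto simp: field_simps)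
  moreover have "?T * ?p * (1 / (1 - pmf q 0)) \<le> (half_var q ^ 2 + ?T) / (1 - pmf q 0) * ?p"
    using pos by (simp add: add_divide_distrib distrib_right)
  ultimately show ?thesis using upper by linarith
qed

lemma inverse_gw_survival_asymp:
  "\<bar>1 / gw_survival q n - half_var q * real n\<bar>
   \<le> 1 + (half_var q ^ 2 + measure_pmf.expectation q (\<lambda>k. real k ^ 3)) / (1 - pmf q 0) * (\<Sum>j<n. gw_survival q j)"
proof (induction n)
  case (Suc n)
  then show ?case
    using inverse_gw_survival_increment[of n] unfolding sum.lessThan_Suc distrib_left of_nat_Suc
    by (simp add: algebra_simps)
qed (simp add: gw_survival_0)

lemma yaglom_discrepancy:
  assumes "contraction h"
  shows "\<bar>pos_part_sum (gw_law q n) h / gw_survival q n - tail_sum (gw_law q n) h\<bar>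
    \<le> (half_var q / (1 - pmf q 0) * measure_pmf.expectation q (\<lambda>k. real k ^ 2)
        + measure_pmf.expectation q (\<lambda>k. real k ^ 3)) * (\<Sum>j<n. gw_survival q j)"
  using assms
proof (induction n arbitrary: h)
  case 0
  \<comment> \<open>As \<open>Z 0 = 1\<close>, both laws are the point mass at 0 and the recursion
    starts with no error.\<close>
  show ?case by (simp add: pos_part_sum_def tail_sum_def shifted_def gw_survival_0)
next
  case (Suc n)
  let ?p = "gw_survival q n" and ?p' = "gw_survival q (Suc n)"
    and ?m2 = "measure_pmf.expectation q (\<lambda>k. real k ^ 2)"
    and ?T = "measure_pmf.expectation q (\<lambda>k. real k ^ 3)"
  have "\<bar>pos_part_sum (gw_law q (Suc n)) h / ?p' - tail_sum (gw_law q (Suc n)) h\<bar>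
    \<le> (half_var q / (1 - pmf q 0) * ?m2 + ?T) * (\<Sum>j<n. gw_survival q j) + (?p / ?p' - 1) * ?m2 + ?p * ?T"
    using yaglom_discrepancy_step[OF q3 q1 _ _ _ _ Suc.IH[unfolded gw_survival_def[of q n]] Suc.prems]
      gw_law_moments[OF offspring_square q1, of n] gw_survival_pos[of "Suc n"] gw_survival_Suc_le[of n]
    by (simp add: gw_survival_def)
  also have "\<dots> \<le> (half_var q / (1 - pmf q 0) * ?m2 + ?T) * (\<Sum>j<n. gw_survival q j)
      + (half_var q / (1 - pmf q 0) * ?p) * ?m2 + ?p * ?T"
    by (intro add_mono order_refl mult_right_mono gw_survival_ratio) auto
  also have "\<dots> = (half_var q / (1 - pmf q 0) * ?m2 + ?T) * (\<Sum>j<Suc n. gw_survival q j)"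
    by (simp add: algebra_simps add_divide_distrib)
  finally show ?case .
qed

end

section \<open>Almost everywhere derivative bounds\<close>

text \<open>Integrating the difference quotients and passing to the limit under the integral sign
  recovers \<open>f b - f a\<close>, so the bound on the derivative need only hold almost everywhere.\<close>

lemma lipschitz_AE_deriv_bound:
  fixes f :: "real \<Rightarrow> real"
  assumes lip: "L-lipschitz_on UNIV f"
    and deriv: "AE x in lborel. f differentiable (at x) \<and> \<bar>deriv f x\<bar> \<le> 1"
    and ab: "a \<le> b"
  shows "\<bar>f b - f a\<bar> \<le> b - a"
proof -
  define \<delta> where "\<delta> n = inverse (real (Suc n))" for n
  have \<delta>: "0 < \<delta> n" "\<delta> n \<le> 1" for n by (auto simp: \<delta>_def field_simps)
  have "\<delta> \<longlonglongrightarrow> 0" unfolding \<delta>_def by (rule LIMSEQ_inverse_real_of_nat)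
  then have \<delta>_lim: "filterlim \<delta> (at 0) sequentially"
    using \<delta>(1) by (auto simp: filterlim_at less_imp_neq[OF \<delta>(1), symmetric])
  define D where "D n x = (f (x + \<delta> n) - f x) / \<delta> n" for n x
  have cont: "continuous_on A f" for A
    using lipschitz_on_continuous_on[OF lip] continuous_on_subset by blast
  have [measurable]: "f \<in> borel_measurable borel"
    using cont by (rule borel_measurable_continuous_onI)
  have D_meas [measurable]: "D n \<in> borel_measurable borel" for n
    unfolding D_def by measurable
  have D_bound: "\<bar>D n x\<bar> \<le> L" for n x
    using lipschitz_onD[OF lip, of "x + \<delta> n" x] \<delta>[of n]
    by (simp add: D_def dist_real_def field_simps)
  have D_lim: "AE x in lborel. (\<lambda>n. D n x) \<longlonglongrightarrow> deriv f x \<and> \<bar>deriv f x\<bar> \<le> 1"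
  proof (rule AE_mp[OF deriv], intro AE_I2 impI, elim conjE)
    fix x assume "f differentiable (at x)"
    then have "(f has_real_derivative deriv f x) (at x)"
      by (simp add: DERIV_deriv_iff_real_differentiable)
    then have "(\<lambda>n. D n x) \<longlonglongrightarrow> deriv f x"
      unfolding DERIV_def D_def by (rule filterlim_compose[OF _ \<delta>_lim])
    moreover assume "\<bar>deriv f x\<bar> \<le> 1"
    ultimately show "(\<lambda>n. D n x) \<longlonglongrightarrow> deriv f x \<and> \<bar>deriv f x\<bar> \<le> 1" by blast
  qed
  \<comment> \<open>As a limit of measurable functions \<open>g\<close> is measurable everywhere,
    while it agrees with \<open>deriv f\<close> only almost everywhere.\<close>
  define g where "g x = lim (\<lambda>n. D n x)" for x
  have [measurable]: "g \<in> borel_measurable borel" unfolding g_def by measurable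
  have g_lim: "AE x in lborel. (\<lambda>n. D n x) \<longlonglongrightarrow> g x \<and> \<bar>g x\<bar> \<le> 1"
    using D_lim by eventually_elim (auto simp: g_def limI)
  have conv: "(\<lambda>n. \<integral>x. indicator {a..b} x *\<^sub>R D n x \<partial>lborel) \<longlonglongrightarrow> (\<integral>x. indicator {a..b} x *\<^sub>R g x \<partial>lborel)"
  proof (rule integral_dominated_convergence)
    show "integrable lborel (\<lambda>x. indicator {a..b} x * L)"
      by (simp add: integrable_real_indicator emeasure_lborel_Icc_eq)
    show "AE x in lborel. (\<lambda>n. indicator {a..b} x *\<^sub>R D n x) \<longlonglongrightarrow> indicator {a..b} x *\<^sub>R g x"
      using g_lim by eventually_elim (auto intro!: tendsto_intros)
    show "AE x in lborel. norm (indicator {a..b} x *\<^sub>R D n x) \<le> indicator {a..b} x * L" for n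
      using D_bound by (intro AE_I2) (auto simp: indicator_def)
  qed measurable
  have "\<bar>\<integral>x. indicator {a..b} x *\<^sub>R g x \<partial>lborel\<bar> \<le> (\<integral>x. \<bar>indicator {a..b} x *\<^sub>R g x\<bar> \<partial>lborel)"
    by (rule integral_abs_bound)
  also have "\<dots> \<le> (\<integral>x. indicator {a..b} x \<partial>lborel)"
  proof (rule integral_mono_AE')
    show "AE x in lborel. \<bar>indicator {a..b} x *\<^sub>R g x\<bar> \<le> indicator {a..b} x"
      using g_lim by eventually_elim (auto simp: indicator_def)
  qed (auto simp: integrable_real_indicator emeasure_lborel_Icc_eq)
  also have "\<dots> = b - a" using ab by simp
  finally have bound: "\<bar>\<integral>x. indicator {a..b} x *\<^sub>R g x \<partial>lborel\<bar> \<le> b - a" .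
  \<comment> \<open>The interval is padded so that \<open>F\<close> has a two-sided derivative at
    \<open>x + \<delta> n\<close> too, that is, up to \<open>b + 1\<close>.\<close>
  obtain F where F: "\<And>x. x \<in> {a - 1..b + 2} \<Longrightarrow> (F has_vector_derivative f x) (at x within {a - 1..b + 2})"
    using antiderivative_continuous[OF cont] by metis
  have F': "(F has_real_derivative f x) (at x)" if "a \<le> x" "x \<le> b + 1" for x
    using F[of x] that at_within_Icc_at[of "a - 1" x "b + 2"]
    by (simp add: has_real_derivative_iff_has_vector_derivative)
  \<comment> \<open>The integrated difference quotient of \<open>f\<close> is a difference of two
    difference quotients of \<open>F\<close>, at \<open>b\<close> and at \<open>a\<close>; these
    tend to \<open>f b\<close> and \<open>f a\<close>.\<close>
  have int: "(\<integral>x. indicator {a..b} x *\<^sub>R D n x \<partial>lborel) = (F (b + \<delta> n) - F b) / \<delta> n - (F (a + \<delta> n) - F a) / \<delta> n" for n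
  proof -
    have "((\<lambda>x. (F (x + \<delta> n) - F x) / \<delta> n) has_real_derivative D n x) (at x)" if "x \<in> {a..b}" for x
      unfolding D_def using that \<delta>[of n] F'[of x] DERIV_shift[of F _ x "\<delta> n"] F'[of "x + \<delta> n"]
      by (intro DERIV_cdivide DERIV_diff) auto
    then have "(\<integral>x. indicator {a..b} x *\<^sub>R D n x \<partial>lborel) = (F (b + \<delta> n) - F b) / \<delta> n - (F (a + \<delta> n) - F a) / \<delta> n"
      using ab \<delta>(1)[of n] unfolding D_def
      by (intro integral_FTC_Icc)
        (auto simp: has_real_derivative_iff_has_vector_derivative[symmetric]
          intro: has_field_derivative_at_within intro!: continuous_intros continuous_on_compose2[OF cont[of UNIV]])
    then show ?thesis .
  qed
  have "(\<lambda>n. (F (x + \<delta> n) - F x) / \<delta> n) \<longlonglongrightarrow> f x" if "a \<le> x" "x \<le> b" for x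
    using F'[of x] that unfolding DERIV_def by (auto intro: filterlim_compose[OF _ \<delta>_lim])
  then have "(\<lambda>n. \<integral>x. indicator {a..b} x *\<^sub>R D n x \<partial>lborel) \<longlonglongrightarrow> f b - f a"
    unfolding int using ab by (intro tendsto_diff) auto
  then show ?thesis
    using LIMSEQ_unique[OF conv] bound by simp
qed

lemma lipschitz_on_borel_measurable:
  fixes f :: "real \<Rightarrow> real"
  shows "L-lipschitz_on UNIV f \<Longrightarrow> f \<in> borel_measurable borel"
  by (rule borel_measurable_continuous_onI[OF lipschitz_on_continuous_on])

section \<open>Stein's method for the exponential law\<close>

abbreviation (input) exponential_law :: "real measure" where
  "exponential_law \<equiv> density lborel (\<lambda>x. ennreal (exponential_density 1 x))"

interpretation exponential_law: prob_space exponential_law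
  by (rule prob_space_exponential_density) simp

lemma exponential_law_distributed:
  "distributed exponential_law lborel (\<lambda>x. x) (\<lambda>x. ennreal (exponential_density 1 x))"
  by (simp add: distributed_def distr_id2)

lemma exponential_law_mean:
  "integrable exponential_law (\<lambda>x. x)" "integral\<^sup>L exponential_law (\<lambda>x. x) = 1"
  using exponential_law.erlang_ith_moment_integrable[OF _ exponential_law_distributed, of 1]
    exponential_law.erlang_ith_moment[OF _ exponential_law_distributed, of 1] by simp_all

lemma AE_exponential_law_nonneg: "AE x in exponential_law. 0 \<le> x"
  by (subst AE_density) (auto simp: exponential_density_def)

lemma exponential_law_memoryless:
  assumes "0 \<le> \<delta>" and [measurable]: "g \<in> borel_measurable borel"
  shows "(\<integral>s. indicator {\<delta>..} s * g s \<partial>exponential_law) = exp (- \<delta>) * (\<integral>s. g (\<delta> + s) \<partial>exponential_law)"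
    (is "?l = ?r")
proof -
  have "?l = (\<integral>s. exponential_density 1 s * (indicator {\<delta>..} s * g s) \<partial>lborel)"
    by (subst integral_density) (auto simp: exponential_density_def)
  also have "\<dots> = (\<integral>s. exponential_density 1 (\<delta> + s) * (indicator {\<delta>..} (\<delta> + s) * g (\<delta> + s)) \<partial>lborel)"
    by (subst lborel_integral_real_affine[where c = 1 and t = \<delta>]) auto
  also have "\<dots> = (\<integral>s. exp (- \<delta>) * (exponential_density 1 s * g (\<delta> + s)) \<partial>lborel)"
    using assms(1) by (intro Bochner_Integration.integral_cong)
      (auto simp: exponential_density_def indicator_def exp_add exp_diff exp_minus field_simps)
  also have "\<dots> = exp (- \<delta>) * (\<integral>s. exponential_density 1 s * g (\<delta> + s) \<partial>lborel)"
    by simp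
  also have "(\<integral>s. exponential_density 1 s * g (\<delta> + s) \<partial>lborel) = (\<integral>s. g (\<delta> + s) \<partial>exponential_law)"
    by (subst integral_density) (auto simp: exponential_density_def)
  finally show ?thesis .
qed

lemma exponential_law_lessThan:
  assumes "0 \<le> \<delta>"
  shows "exponential_law.prob {..<\<delta>} = 1 - exp (- \<delta>)"
proof -
  have "exponential_law.prob {\<delta>..} = exp (- \<delta>)"
    using exponential_law_memoryless[OF assms, of "\<lambda>_. 1"] exponential_law.prob_space by simp
  moreover have "space exponential_law - {\<delta>..} = {..<\<delta>}" by auto
  ultimately show ?thesis
    using exponential_law.prob_compl[of "{\<delta>..}"] by simp
qed

context
  fixes h :: "real \<Rightarrow> real"
  assumes h: "1-lipschitz_on UNIV h"
begin

lemma lipschitz_abs_diff: "\<bar>h x - h y\<bar> \<le> \<bar>x - y\<bar>"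
  using lipschitz_onD[OF h, of x y] by (simp add: dist_real_def)

definition exp_smooth :: "real \<Rightarrow> real" where
  "exp_smooth x = (\<integral>s. h (x + s) \<partial>exponential_law)"

lemma integrable_exponential_shift: "integrable exponential_law (\<lambda>s. h (x + s))"
  supply lipschitz_on_borel_measurable[OF h, measurable]
proof (rule Bochner_Integration.integrable_bound)
  show "integrable exponential_law (\<lambda>s. \<bar>h x\<bar> + \<bar>s\<bar>)"
    using exponential_law_mean(1) by simp
  show "AE s in exponential_law. norm (h (x + s)) \<le> norm (\<bar>h x\<bar> + \<bar>s\<bar>)"
    using lipschitz_abs_diff[of "x + _" x] by (intro AE_I2) (simp, smt (verit))
qed simp

lemma exp_smootlipschitz_abs_diff: "\<bar>exp_smooth x - exp_smooth y\<bar> \<le> \<bar>x - y\<bar>"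
proof -
  have "\<bar>exp_smooth x - exp_smooth y\<bar> = \<bar>\<integral>s. h (x + s) - h (y + s) \<partial>exponential_law\<bar>"
    using integrable_exponential_shift by (simp add: exp_smooth_def)
  also have "\<dots> \<le> (\<integral>s. \<bar>h (x + s) - h (y + s)\<bar> \<partial>exponential_law)"
    by (rule integral_abs_bound)
  also have "\<dots> \<le> \<bar>x - y\<bar>"
    using integrable_exponential_shift lipschitz_abs_diff[of "x + s" "y + s" for s]
    by (intro exponential_law.integral_le_const AE_I2) auto
  finally show ?thesis .
qed

lemma exp_smooth_near: "\<bar>exp_smooth x - h x\<bar> \<le> 1"
proof -
  have "\<bar>exp_smooth x - h x\<bar> = \<bar>\<integral>s. h (x + s) - h x \<partial>exponential_law\<bar>"
    using integrable_exponential_shift exponential_law.prob_space by (simp add: exp_smooth_def)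
  also have "\<dots> \<le> (\<integral>s. \<bar>h (x + s) - h x\<bar> \<partial>exponential_law)"
    by (rule integral_abs_bound)
  also have "\<dots> \<le> (\<integral>s. s \<partial>exponential_law)"
  proof (rule integral_mono_AE)
    show "AE s in exponential_law. \<bar>h (x + s) - h x\<bar> \<le> s"
      using AE_exponential_law_nonneg
    proof eventually_elim
      fix s :: real assume "0 \<le> s"
      then show "\<bar>h (x + s) - h x\<bar> \<le> s" using lipschitz_abs_diff[of "x + s" x] by simp
    qed
  qed (use integrable_exponential_shift exponential_law_mean in auto)
  finally show ?thesis using exponential_law_mean by simp
qed

text \<open>A discrete form of \<open>S' = S - h\<close> for \<open>S = exp_smooth\<close>, which
  avoids derivatives. By lack of memory, \<open>S x\<close> is the part of the integral over
  \<open>s < \<delta>\<close> plus \<open>exp (- \<delta>) * S (x + \<delta>)\<close>. The error is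
  therefore an integral over \<open>s < \<delta>\<close> alone, where \<open>h (x + s)\<close> is
  replaced by \<open>h x\<close> and \<open>S (x + \<delta>)\<close> by \<open>S x\<close>, each at
  cost at most \<open>\<delta>\<close>.\<close>

lemma exp_smooth_increment:
  assumes \<delta>: "0 \<le> \<delta>"
  shows "\<bar>exp_smooth (x + \<delta>) - exp_smooth x - (1 - exp (- \<delta>)) * (exp_smooth x - h x)\<bar>
    \<le> 2 * \<delta> * (1 - exp (- \<delta>))"
proof -
  note [measurable] = lipschitz_on_borel_measurable[OF h]
  note int = integrable_exponential_shift[of x]
  have pointwise: "\<bar>indicator {..<\<delta>} s * (exp_smooth (x + \<delta>) - exp_smooth x + h x)
      - indicator {..<\<delta>} s * h (x + s)\<bar> \<le> indicator {..<\<delta>} s * (2 * \<delta>)" if s: "0 \<le> s" for s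
  proof (cases "s < \<delta>")
    case True
    have "\<bar>exp_smooth (x + \<delta>) - exp_smooth x\<bar> \<le> \<delta>"
      using exp_smootlipschitz_abs_diff[of "x + \<delta>" x] \<delta> by simp
    moreover have "\<bar>h (x + s) - h x\<bar> \<le> s"
      using lipschitz_abs_diff[of "x + s" x] s by simp
    ultimately have "\<bar>(exp_smooth (x + \<delta>) - exp_smooth x + h x) - h (x + s)\<bar> \<le> 2 * \<delta>"
      using True unfolding abs_le_iff by linarith
    then show ?thesis using True by simp
  qed simp
  have i1: "integrable exponential_law (\<lambda>s. indicator {..<\<delta>} s * h (x + s))"
    and i2: "integrable exponential_law (\<lambda>s. indicator {\<delta>..} s * h (x + s))"
    by (rule Bochner_Integration.integrable_bound[OF int], auto simp: indicator_def)+
  have ind: "integrable exponential_law (indicator {..<\<delta>} :: real \<Rightarrow> real)"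
    by (rule exponential_law.integrable_const_bound[where B = 1]) auto
  have "exp_smooth x = (\<integral>s. indicator {..<\<delta>} s * h (x + s) + indicator {\<delta>..} s * h (x + s) \<partial>exponential_law)"
    unfolding exp_smooth_def by (intro Bochner_Integration.integral_cong) (auto simp: indicator_def)
  also have "\<dots> = (\<integral>s. indicator {..<\<delta>} s * h (x + s) \<partial>exponential_law) + exp (- \<delta>) * exp_smooth (x + \<delta>)"
    using i1 i2 exponential_law_memoryless[OF \<delta>, of "\<lambda>s. h (x + s)"] by (simp add: exp_smooth_def add.assoc)
  finally have I: "(\<integral>s. indicator {..<\<delta>} s * h (x + s) \<partial>exponential_law)
      = exp_smooth x - exp (- \<delta>) * exp_smooth (x + \<delta>)" by simp
  define F where "F s = indicator {..<\<delta>} s * (exp_smooth (x + \<delta>) - exp_smooth x + h x)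
      - indicator {..<\<delta>} s * h (x + s)" for s
  have F_int: "integrable exponential_law F"
    unfolding F_def by (intro Bochner_Integration.integrable_diff integrable_mult_left i1 ind)
  have eq: "exp_smooth (x + \<delta>) - exp_smooth x - (1 - exp (- \<delta>)) * (exp_smooth x - h x)
    = (\<integral>s. F s \<partial>exponential_law)"
    unfolding F_def
    using i1 ind exponential_law_lessThan[OF \<delta>] by (simp add: I) (simp add: algebra_simps)
  have "\<bar>\<integral>s. F s \<partial>exponential_law\<bar> \<le> (\<integral>s. \<bar>F s\<bar> \<partial>exponential_law)"
    by (rule integral_abs_bound)
  also have "\<dots> \<le> (\<integral>s. indicator {..<\<delta>} s * (2 * \<delta>) \<partial>exponential_law)"
  proof (rule integral_mono_AE)
    show "AE s in exponential_law. \<bar>F s\<bar> \<le> indicator {..<\<delta>} s * (2 * \<delta>)"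
      unfolding F_def by (rule AE_mp[OF AE_exponential_law_nonneg]) (intro AE_I2 impI pointwise)
  qed (use F_int ind in simp_all)
  also have "\<dots> = 2 * \<delta> * (1 - exp (- \<delta>))"
    using ind exponential_law_lessThan[OF \<delta>] by simp
  finally show ?thesis unfolding eq .
qed

text \<open>The function \<open>exp_smooth\<close> is, up to sign and an additive constant, the solution \<open>f\<close> of the
  Stein equation \<open>f' - f = h - \<integral>h dExp(1)\<close> with \<open>f 0 = 0\<close>. Telescoping \<open>f (p Z)\<close> over the
  lattice of mesh \<open>p\<close> turns the expectation of \<open>f\<close> into a \<open>tail_sum\<close> of \<open>f'\<close>.\<close>

lemma exponential_approximation:
  fixes \<mu> :: "nat pmf"
  defines "p \<equiv> 1 - pmf \<mu> 0"
  assumes sq: "integrable (measure_pmf \<mu>) (\<lambda>z. real z ^ 2)"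
    and mean: "measure_pmf.expectation \<mu> real = 1"
    and p: "0 < p"
    and w: "\<And>g. contraction g \<Longrightarrow> \<bar>pos_part_sum \<mu> g / p - tail_sum \<mu> g\<bar> \<le> w"
  shows "\<bar>measure_pmf.expectation \<mu> (\<lambda>z. if z = 0 then 0 else h (p * real z)) / p
      - integral\<^sup>L exponential_law h\<bar> \<le> p * (5 + 2 * w)"
proof -
  define \<psi> where "\<psi> x = exp_smooth x - h x" for x
  define r where "r = 1 - exp (- p)"
  \<comment> \<open>\<open>\<psi>\<close> is 2-Lipschitz and is sampled with mesh \<open>p\<close>;
    division by \<open>2 * p\<close> makes \<open>g\<close> a contraction.\<close>
  define g where "g k = \<psi> (p * real k) / (2 * p)" for k
  have p1: "p \<le> 1" by (simp add: p_def)
  have r0: "0 \<le> r" using p by (simp add: r_def)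
  have rp: "r \<le> p" using exp_ge_add_one_self[of "- p"] by (simp add: r_def)
  have "1 + p \<le> exp p" by (rule exp_ge_add_one_self)
  then have "exp (- p) \<le> 1 / (1 + p)"
    using p by (simp add: exp_minus field_simps)
  also have "\<dots> \<le> 1 - p + p ^ 2"
    using p by (simp add: field_simps power2_eq_square)
  finally have pr: "p - r \<le> p ^ 2" by (simp add: r_def)
  have \<psi>_eq: "\<psi> (p * real k) = 2 * p * g k" for k
    using p by (simp add: g_def)
  have \<psi>_lip: "\<bar>\<psi> x - \<psi> y\<bar> \<le> 2 * \<bar>x - y\<bar>" for x y
    using exp_smootlipschitz_abs_diff[of x y] lipschitz_abs_diff[of x y] unfolding \<psi>_def
    by (smt (verit))
  have g: "contraction g"
    unfolding contraction_def
  proof (intro allI)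
    fix j k
    have "\<bar>\<psi> (p * real j) - \<psi> (p * real k)\<bar> \<le> 2 * \<bar>p * real j - p * real k\<bar>"
      by (rule \<psi>_lip)
    also have "\<dots> = 2 * p * \<bar>real j - real k\<bar>"
      using p by (simp add: abs_mult flip: right_diff_distrib)
    finally show "\<bar>g j - g k\<bar> \<le> \<bar>real j - real k\<bar>"
      using p by (simp add: g_def field_simps flip: diff_divide_distrib)
  qed
  have gS: "contraction (\<lambda>k. g (Suc k))" and gS': "\<And>k. \<bar>g k - g (Suc k)\<bar> \<le> 1"
    using contraction_shift[OF g, of 1] contraction_shift_diff[OF g, of _ 1] by auto
  have g_bound: "\<bar>g k\<bar> \<le> 1 / (2 * p)" for k
    using exp_smooth_near[of "p * real k"] p by (simp add: g_def \<psi>_def field_simps)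
  have "\<bar>tail_sum \<mu> g - tail_sum \<mu> (\<lambda>_. 0)\<bar> \<le> 1 / (2 * p)"
    using g_bound by (intro tail_sum_lipschitz[OF sq mean g]) (auto simp: contraction_def)
  then have tail_bound: "\<bar>tail_sum \<mu> g\<bar> \<le> 1 / (2 * p)"
    by (simp add: tail_sum_def)
  define H where "H z = exp_smooth (p * real z) - exp_smooth 0" for z :: nat
  have H_int: "integrable \<mu> H"
  proof (rule Bochner_Integration.integrable_bound[OF integrable_real_of_square[OF sq]])
    show "AE z in \<mu>. norm (H z) \<le> norm (real z)"
    proof (intro AE_I2)
      fix z :: nat
      have "\<bar>H z\<bar> \<le> p * real z"
        using exp_smootlipschitz_abs_diff[of "p * real z" 0] p by (simp add: H_def)
      also have "\<dots> \<le> real z" using p p1 by (simp add: mult_left_le_one_le)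
      finally show "norm (H z) \<le> norm (real z)" by simp
    qed
  qed simp
  have H_bound: "\<bar>H z - r * (2 * p) * (\<Sum>k<z. g k)\<bar> \<le> real z * (2 * p * r)" for z
  proof (induction z)
    case (Suc z)
    have "\<bar>exp_smooth (p * real z + p) - exp_smooth (p * real z) - r * (2 * p * g z)\<bar> \<le> 2 * p * r"
      using exp_smooth_increment[of p "p * real z"] p \<psi>_eq[of z] by (simp add: r_def \<psi>_def)
    moreover have "H (Suc z) = H z + (exp_smooth (p * real z + p) - exp_smooth (p * real z))"
      by (simp add: H_def algebra_simps)
    ultimately show ?case using Suc by (simp add: algebra_simps)
  qed (simp add: H_def)
  have "\<bar>measure_pmf.expectation \<mu> H - r * (2 * p) * tail_sum \<mu> g\<bar>
      = \<bar>measure_pmf.expectation \<mu> (\<lambda>z. H z - r * (2 * p) * (\<Sum>k<z. g k))\<bar>"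
    using H_int integrable_sum_contraction[OF sq mean g] by (simp add: tail_sum_def)
  also have "\<dots> \<le> measure_pmf.expectation \<mu> (\<lambda>z. \<bar>H z - r * (2 * p) * (\<Sum>k<z. g k)\<bar>)"
    by (rule integral_abs_bound)
  also have "\<dots> \<le> measure_pmf.expectation \<mu> (\<lambda>z. real z * (2 * p * r))"
    using H_int integrable_sum_contraction[OF sq mean g] H_bound integrable_real_of_square[OF sq]
    by (intro integral_mono) auto
  also have "\<dots> = 2 * p * r" using mean by simp
  finally have t1: "\<bar>measure_pmf.expectation \<mu> H - r * (2 * p) * tail_sum \<mu> g\<bar> \<le> 2 * p * r" .
  \<comment> \<open>This is \<open>h = S - \<psi>\<close> at \<open>p * z\<close>. Since
    \<open>shifted\<close> looks at \<open>z - 1\<close>, the value \<open>g z\<close> appears as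
    that of \<open>\<lambda>k. g (Suc k)\<close>.\<close>
  have split: "(if z = 0 then 0 else h (p * real z))
      = exp_smooth 0 * indicator (- {0}) z + H z - 2 * p * shifted (\<lambda>k. g (Suc k)) z" for z
    using \<psi>_eq[of z] by (auto simp: shifted_def H_def \<psi>_def)
  have Ep: "measure_pmf.expectation \<mu> (indicator (- {0})) = p"
    using measure_pmf.prob_compl[of "{0}" \<mu>] by (simp add: measure_pmf_single Compl_eq_Diff_UNIV p_def)
  have "measure_pmf.expectation \<mu> (\<lambda>z. if z = 0 then 0 else h (p * real z))
      = exp_smooth 0 * p + measure_pmf.expectation \<mu> H - 2 * p * pos_part_sum \<mu> (\<lambda>k. g (Suc k))"
    unfolding split using H_int integrable_shifted_contraction[OF sq mean gS] Ep
    by (simp add: pos_part_sum_def integrable_pmf_indicator)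
  then have "measure_pmf.expectation \<mu> (\<lambda>z. if z = 0 then 0 else h (p * real z)) / p - exp_smooth 0
      = measure_pmf.expectation \<mu> H / p - 2 * pos_part_sum \<mu> (\<lambda>k. g (Suc k))"
    using p by (simp add: field_simps)
  moreover have "\<bar>measure_pmf.expectation \<mu> H / p - 2 * r * tail_sum \<mu> g\<bar> \<le> 2 * p"
  proof -
    have "measure_pmf.expectation \<mu> H / p - 2 * r * tail_sum \<mu> g
        = (measure_pmf.expectation \<mu> H - r * (2 * p) * tail_sum \<mu> g) / p"
      using p by (simp add: field_simps)
    also have "\<bar>\<dots>\<bar> \<le> 2 * p * r / p"
      using t1 p by (simp add: pos_divide_le_eq mult_ac)
    finally show ?thesis using rp p by simp
  qed
  moreover have "\<bar>2 * p * tail_sum \<mu> g - 2 * r * tail_sum \<mu> g\<bar> \<le> p"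
  proof -
    have "2 * p * tail_sum \<mu> g - 2 * r * tail_sum \<mu> g = 2 * (p - r) * tail_sum \<mu> g"
      by (simp add: algebra_simps)
    then have "\<bar>2 * p * tail_sum \<mu> g - 2 * r * tail_sum \<mu> g\<bar> = 2 * (p - r) * \<bar>tail_sum \<mu> g\<bar>"
      using rp by (simp add: abs_mult)
    also have "\<dots> \<le> 2 * p ^ 2 * (1 / (2 * p))"
      using pr tail_bound rp by (intro mult_mono) auto
    finally show ?thesis using p by (simp add: power2_eq_square)
  qed
  moreover have "\<bar>2 * pos_part_sum \<mu> g - 2 * p * tail_sum \<mu> g\<bar> \<le> 2 * p * w"
  proof -
    have "2 * pos_part_sum \<mu> g - 2 * p * tail_sum \<mu> g = 2 * p * (pos_part_sum \<mu> g / p - tail_sum \<mu> g)"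
      using p by (simp add: field_simps)
    also have "\<bar>\<dots>\<bar> \<le> 2 * p * w"
      using w[OF g] p by (simp add: abs_mult)
    finally show ?thesis .
  qed
  moreover have "\<bar>pos_part_sum \<mu> g - pos_part_sum \<mu> (\<lambda>k. g (Suc k))\<bar> \<le> p"
    using pos_part_sum_lipschitz[OF sq mean g gS gS'] by (simp add: p_def)
  \<comment> \<open>In order: \<open>2 * p\<close> for discretising the Stein equation;
    \<open>p\<close> for replacing \<open>r\<close> by \<open>p\<close>, where
    \<open>p - r \<le> p ^ 2\<close> meets a \<open>tail_sum\<close> of size
    \<open>1 / (2 * p)\<close>; \<open>2 * p * w\<close> for exchanging equilibrium and conditional
    law; \<open>2 * p\<close> for the shift from \<open>g (Suc k)\<close> to
    \<open>g k\<close>.\<close>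
  ultimately have "\<bar>measure_pmf.expectation \<mu> (\<lambda>z. if z = 0 then 0 else h (p * real z)) / p - exp_smooth 0\<bar>
      \<le> 2 * p + p + 2 * p * w + 2 * p"
    by linarith
  then show ?thesis by (simp add: exp_smooth_def algebra_simps)
qed

end

section \<open>The law of the Galton--Watson process\<close>

lemma measurable_sum_count_space:
  fixes f :: "'i \<Rightarrow> 'b \<Rightarrow> nat"
  assumes "\<And>i. i \<in> S \<Longrightarrow> f i \<in> measurable M (count_space UNIV)"
  shows "(\<lambda>x. \<Sum>i\<in>S. f i x) \<in> measurable M (count_space UNIV)"
  using borel_measurable_sum[of S f M] assms
  by (simp add: measurable_cong_sets[OF refl sets_borel_eq_count_space])

text \<open>Decompose by the value of \<open>X\<close>: on the event \<open>X = k\<close> only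
  \<open>Y k\<close> is seen, so independence is used for one \<open>k\<close> at a time.\<close>

lemma (in prob_space) distr_indep_compose:
  fixes X :: "'a \<Rightarrow> nat" and Y :: "nat \<Rightarrow> 'a \<Rightarrow> nat"
  assumes indep: "\<And>k. indep_var (count_space UNIV) X (count_space UNIV) (Y k)"
    and X: "distr M (count_space UNIV) X = measure_pmf a"
    and Y: "\<And>k. distr M (count_space UNIV) (Y k) = measure_pmf (F k)"
  shows "distr M (count_space UNIV) (\<lambda>\<omega>. Y (X \<omega>) \<omega>) = measure_pmf (bind_pmf a F)"
proof (rule measure_eqI_countable[where A = UNIV])
  have X_meas [measurable]: "X \<in> measurable M (count_space UNIV)"
    and Y_meas [measurable]: "\<And>k. Y k \<in> measurable M (count_space UNIV)"
    using indep by (auto simp: indep_var_eq)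
  have W_meas [measurable]: "(\<lambda>\<omega>. Y (X \<omega>) \<omega>) \<in> measurable M (count_space UNIV)"
    by (rule measurable_compose_countable) measurable
  fix m :: nat
  have X': "emeasure M (X -` {k} \<inter> space M) = emeasure (measure_pmf a) {k}" for k
    using X_meas by (simp add: X[symmetric] emeasure_distr)
  have Y': "emeasure M (Y k -` {m} \<inter> space M) = emeasure (measure_pmf (F k)) {m}" for k
    using Y_meas by (simp add: Y[symmetric] emeasure_distr)
  have prod: "emeasure M ((\<lambda>\<omega>. (X \<omega>, Y k \<omega>)) -` ({k} \<times> {m}) \<inter> space M)
      = ennreal (pmf a k) * emeasure (measure_pmf (F k)) {m}" for k
  proof -
    have "prob ((\<lambda>\<omega>. (X \<omega>, Y k \<omega>)) -` ({k} \<times> {m}) \<inter> space M)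
        = prob (X -` {k} \<inter> space M) * prob (Y k -` {m} \<inter> space M)"
      by (rule indep_varD[OF indep]) auto
    then have "emeasure M ((\<lambda>\<omega>. (X \<omega>, Y k \<omega>)) -` ({k} \<times> {m}) \<inter> space M)
        = emeasure M (X -` {k} \<inter> space M) * emeasure M (Y k -` {m} \<inter> space M)"
      by (simp only: emeasure_eq_measure ennreal_mult[OF measure_nonneg measure_nonneg])
    then show ?thesis unfolding X' Y' by (simp add: emeasure_pmf_single)
  qed
  have "emeasure (distr M (count_space UNIV) (\<lambda>\<omega>. Y (X \<omega>) \<omega>)) {m}
      = emeasure M ((\<lambda>\<omega>. Y (X \<omega>) \<omega>) -` {m} \<inter> space M)"
    by (simp add: emeasure_distr)
  also have "(\<lambda>\<omega>. Y (X \<omega>) \<omega>) -` {m} \<inter> space M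
      = (\<Union>k. (\<lambda>\<omega>. (X \<omega>, Y k \<omega>)) -` ({k} \<times> {m}) \<inter> space M)"
    by auto
  also have "emeasure M \<dots> = (\<Sum>k. emeasure M ((\<lambda>\<omega>. (X \<omega>, Y k \<omega>)) -` ({k} \<times> {m}) \<inter> space M))"
  proof (rule suminf_emeasure[symmetric])
    have "(\<lambda>\<omega>. (X \<omega>, Y k \<omega>)) -` ({k} \<times> {m}) \<inter> space M
        = (X -` {k} \<inter> space M) \<inter> (Y k -` {m} \<inter> space M)" for k by auto
    then show "range (\<lambda>k. (\<lambda>\<omega>. (X \<omega>, Y k \<omega>)) -` ({k} \<times> {m}) \<inter> space M) \<subseteq> events"
      by (auto intro!: sets.Int measurable_sets[OF X_meas] measurable_sets[OF Y_meas])
  qed (auto simp: disjoint_family_on_def)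
  also have "\<dots> = emeasure (measure_pmf (bind_pmf a F)) {m}"
    unfolding prod by (simp add: nn_integral_measure_pmf nn_integral_count_space_nat)
  finally show "emeasure (distr M (count_space UNIV) (\<lambda>\<omega>. Y (X \<omega>) \<omega>)) {m}
      = emeasure (measure_pmf (bind_pmf a F)) {m}" .
qed auto

text \<open>The process as a deterministic function of the offspring array. It shows that generation
  \<open>n\<close> reads only entries with second index up to \<open>n\<close>, whence its
  independence of the next generation's offspring numbers.\<close>

primrec gw_path :: "(nat \<times> nat \<Rightarrow> nat) \<Rightarrow> nat \<Rightarrow> nat" where
  "gw_path x 0 = 1"
| "gw_path x (Suc n) = (\<Sum>i = 1..gw_path x n. x (i, Suc n))"

lemma gw_path_measurable:
  "n \<le> N \<Longrightarrow> (\<lambda>x. gw_path x n) \<in> measurable (PiM ({1..} \<times> {1..N}) (\<lambda>_. count_space UNIV)) (count_space UNIV)"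
proof (induction n)
  case (Suc n)
  have "(\<lambda>x. \<Sum>i = 1..k. x (i, Suc n) :: nat) \<in> measurable (PiM ({1..} \<times> {1..N}) (\<lambda>_. count_space UNIV)) (count_space UNIV)"
    for k :: nat
  proof (rule measurable_sum_count_space)
    show "(\<lambda>x. x (i, Suc n) :: nat) \<in> measurable (PiM ({1..} \<times> {1..N}) (\<lambda>_. count_space UNIV)) (count_space UNIV)"
      if "i \<in> {1..k}" for i
      using that Suc.prems by (auto intro!: measurable_component_singleton)
  qed
  then show ?case
    unfolding gw_path.simps
    by (rule measurable_compose_countable[where f = "\<lambda>k x. \<Sum>i = 1..k. x (i, Suc n)"])
      (use Suc in simp)
qed simp

lemma gw_path_restrict: "n \<le> N \<Longrightarrow> gw_path (restrict x ({1..} \<times> {1..N})) n = gw_path x n"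
  by (induction n) (auto intro!: sum.cong)

context galton_watson
begin

lemma offspring_blocks_indep:
  assumes "A \<inter> B = {}" "A \<subseteq> {1..} \<times> {1..}" "B \<subseteq> {1..} \<times> {1..}"
    and "f \<in> measurable (PiM A (\<lambda>_. count_space UNIV)) (count_space UNIV)"
    and "g \<in> measurable (PiM B (\<lambda>_. count_space UNIV)) (count_space UNIV)"
  shows "indep_var (count_space UNIV) (\<lambda>\<omega>. f (restrict (\<lambda>(i, n). \<xi> i n \<omega>) A))
    (count_space UNIV) (\<lambda>\<omega>. g (restrict (\<lambda>(i, n). \<xi> i n \<omega>) B))"
  using indep_var_compose[OF indep_var_restrict[OF offspring_indep assms(1-3)] assms(4,5)]
  by (simp add: o_def case_prod_unfold)

lemma offspring_measurable: "1 \<le> i \<Longrightarrow> 1 \<le> n \<Longrightarrow> \<xi> i n \<in> measurable M (count_space UNIV)"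
  using offspring_indep by (force simp: indep_vars_def)

lemma distr_sum_offspring:
  "distr M (count_space UNIV) (\<lambda>\<omega>. \<Sum>i = 1..k. \<xi> i (Suc n) \<omega>) = measure_pmf (conv_power q k)"
proof (induction k)
  case 0
  show ?case by (auto intro!: measure_eqI simp: emeasure_distr emeasure_space_1 indicator_def)
next
  case (Suc k)
  have "distr M (count_space UNIV) (\<lambda>\<omega>. (\<Sum>i = 1..k. \<xi> i (Suc n) \<omega>) + \<xi> (Suc k) (Suc n) \<omega>)
      = measure_pmf (bind_pmf (conv_power q k) (\<lambda>s. map_pmf (\<lambda>z. s + z) q))"
  proof (rule distr_indep_compose[where Y = "\<lambda>s \<omega>. s + \<xi> (Suc k) (Suc n) \<omega>", OF _ Suc.IH])
    fix s
    have "indep_var (count_space UNIV)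
        (\<lambda>\<omega>. (\<lambda>x. \<Sum>i = 1..k. x (i, Suc n)) (restrict (\<lambda>(i, n). \<xi> i n \<omega>) ({1..k} \<times> {Suc n})))
        (count_space UNIV) (\<lambda>\<omega>. (\<lambda>x. s + x (Suc k, Suc n)) (restrict (\<lambda>(i, n). \<xi> i n \<omega>) {(Suc k, Suc n)}))"
      by (rule offspring_blocks_indep)
        (auto intro!: measurable_sum_count_space measurable_component_singleton
            measurable_compose[OF measurable_component_singleton])
    then show "indep_var (count_space UNIV) (\<lambda>\<omega>. \<Sum>i = 1..k. \<xi> i (Suc n) \<omega>)
        (count_space UNIV) (\<lambda>\<omega>. s + \<xi> (Suc k) (Suc n) \<omega>)"
      by simp
    show "distr M (count_space UNIV) (\<lambda>\<omega>. s + \<xi> (Suc k) (Suc n) \<omega>) = measure_pmf (map_pmf (\<lambda>z. s + z) q)"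
      using offspring_measurable[of "Suc k" "Suc n"]
      by (simp add: map_pmf_rep_eq offspring_law[of "Suc k" "Suc n", symmetric] distr_distr o_def)
  qed
  then show ?case by simp
qed

lemma Z_eq_gw_path: "\<omega> \<in> space M \<Longrightarrow> Z n \<omega> = gw_path (\<lambda>(i, n). \<xi> i n \<omega>) n"
  by (induction n) (auto simp: Z_0 Z_step)

lemma Z_law: "distr M (count_space UNIV) (Z n) = measure_pmf (gw_law q n)"
proof (induction n)
  case 0
  have "distr M (count_space UNIV) (Z 0) = distr M (count_space UNIV) (\<lambda>_. 1)"
    by (rule distr_cong) (auto simp: Z_0)
  also have "\<dots> = measure_pmf (gw_law q 0)"
    by (auto intro!: measure_eqI simp: emeasure_distr emeasure_space_1 indicator_def)
  finally show ?case .
next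
  case (Suc n)
  let ?X = "\<lambda>\<omega>. gw_path (\<lambda>(i, n). \<xi> i n \<omega>) n"
  have "distr M (count_space UNIV) (Z (Suc n))
      = distr M (count_space UNIV) (\<lambda>\<omega>. \<Sum>i = 1..?X \<omega>. \<xi> i (Suc n) \<omega>)"
    by (rule distr_cong) (auto simp: Z_eq_gw_path)
  also have "\<dots> = measure_pmf (bind_pmf (gw_law q n) (conv_power q))"
  proof (rule distr_indep_compose[where Y = "\<lambda>k \<omega>. \<Sum>i = 1..k. \<xi> i (Suc n) \<omega>", OF _ _ distr_sum_offspring])
    have "distr M (count_space UNIV) ?X = distr M (count_space UNIV) (Z n)"
      by (rule distr_cong) (auto simp: Z_eq_gw_path)
    then show "distr M (count_space UNIV) ?X = measure_pmf (gw_law q n)"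
      using Suc by simp
    fix k
    have "indep_var (count_space UNIV)
        (\<lambda>\<omega>. (\<lambda>x. gw_path x n) (restrict (\<lambda>(i, n). \<xi> i n \<omega>) ({1..} \<times> {1..n})))
        (count_space UNIV) (\<lambda>\<omega>. (\<lambda>x. \<Sum>i = 1..k. x (i, Suc n)) (restrict (\<lambda>(i, n). \<xi> i n \<omega>) ({1..k} \<times> {Suc n})))"
      by (rule offspring_blocks_indep)
        (auto simp del: One_nat_def
          intro!: measurable_sum_count_space measurable_component_singleton gw_path_measurable)
    then show "indep_var (count_space UNIV) ?X (count_space UNIV) (\<lambda>\<omega>. \<Sum>i = 1..k. \<xi> i (Suc n) \<omega>)"
      by (simp add: gw_path_restrict del: One_nat_def)
  qed
  finally show ?case unfolding gw_law_Suc' .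
qed

lemma Z_measurable [measurable]: "Z n \<in> measurable M (count_space UNIV)"
proof -
  have "(\<lambda>\<omega>. gw_path (restrict (\<lambda>(i, n). \<xi> i n \<omega>) ({1..} \<times> {1..n})) n) \<in> measurable M (count_space UNIV)"
    using offspring_measurable
    by (intro measurable_compose[OF measurable_restrict gw_path_measurable]) auto
  then show ?thesis
    by (rule measurable_cong[THEN iffD1, rotated]) (simp only: gw_path_restrict[OF order_refl] Z_eq_gw_path)
qed

lemma
  fixes g :: "nat \<Rightarrow> real"
  shows integral_Z: "(\<integral>\<omega>. g (Z n \<omega>) \<partial>M) = measure_pmf.expectation (gw_law q n) g"
    and integrable_Z: "integrable M (\<lambda>\<omega>. g (Z n \<omega>)) \<longleftrightarrow> integrable (gw_law q n) g"
  unfolding Z_law[symmetric] by (simp_all add: integral_distr integrable_distr_eq)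

lemma prob_Z_pos: "\<P>(\<omega> in M. Z n \<omega> > 0) = gw_survival q n"
proof -
  have "\<P>(\<omega> in M. Z n \<omega> > 0) = measure (distr M (count_space UNIV) (Z n)) (- {0})"
    by (subst measure_distr) (auto intro!: arg_cong[where f = prob])
  also have "\<dots> = gw_survival q n"
    using measure_pmf.prob_compl[of "{0}" "gw_law q n"]
    by (simp add: Z_law gw_survival_def measure_pmf_single Compl_eq_Diff_UNIV)
  finally show ?thesis .
qed

lemma integral_cond_law:
  assumes [measurable]: "f \<in> borel_measurable borel" and pos: "0 < gw_survival q n"
  shows "(\<integral>x. f x \<partial>cond_law M (\<lambda>\<omega>. c * real (Z n \<omega>)) (\<lambda>\<omega>. Z n \<omega> > 0))
    = measure_pmf.expectation (gw_law q n) (\<lambda>z. if z = 0 then 0 else f (c * real z)) / gw_survival q n"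
proof -
  let ?A = "{\<omega> \<in> space M. Z n \<omega> > 0}" and ?p = "gw_survival q n"
  have "uniform_measure M ?A = density M (\<lambda>\<omega>. ennreal (indicator ?A \<omega> / ?p))"
    unfolding uniform_measure_def emeasure_eq_measure prob_Z_pos
    using pos by (intro arg_cong[where f = "density M"] ext)
      (simp add: divide_ennreal[symmetric] ennreal_indicator)
  then have "(\<integral>x. f x \<partial>cond_law M (\<lambda>\<omega>. c * real (Z n \<omega>)) (\<lambda>\<omega>. Z n \<omega> > 0))
      = (\<integral>\<omega>. f (c * real (Z n \<omega>)) \<partial>density M (\<lambda>\<omega>. ennreal (indicator ?A \<omega> / ?p)))"
    unfolding cond_law_def
    by (simp only:) (intro integral_distr, simp_all add: measurable_cong_sets[OF sets_density refl])
  also have "\<dots> = (\<integral>\<omega>. (indicator ?A \<omega> / ?p) *\<^sub>R f (c * real (Z n \<omega>)) \<partial>M)"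
    using pos by (subst integral_density) auto
  also have "\<dots> = (\<integral>\<omega>. (if Z n \<omega> = 0 then 0 else f (c * real (Z n \<omega>))) / ?p \<partial>M)"
    by (intro Bochner_Integration.integral_cong) (auto simp: indicator_def)
  also have "\<dots> = (\<integral>\<omega>. (\<lambda>z. if z = 0 then 0 else f (c * real z)) (Z n \<omega>) \<partial>M) / ?p"
    by simp
  also note integral_Z
  finally show ?thesis .
qed

end

section \<open>From test functions to the two Wasserstein bounds\<close>

lemma pmf_0_pos_of_mean_1:
  fixes q :: "nat pmf"
  assumes int: "integrable (measure_pmf q) real" and mean: "measure_pmf.expectation q real = 1"
    and "pmf q 1 \<noteq> 1"
  shows "0 < pmf q 0"
proof (rule ccontr)
  assume "\<not> 0 < pmf q 0"
  then have "pmf q 0 = 0" using pmf_nonneg[of q 0] by linarith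
  then have ge: "1 \<le> k" if "k \<in> set_pmf q" for k
    using that by (cases k) (auto simp: set_pmf_eq)
  \<comment> \<open>Without mass at 0 the variable \<open>k - 1\<close> is nonnegative with mean 0,
    hence vanishes, and \<open>q\<close> is the excluded point mass at 1.\<close>
  have "AE k in q. real k - 1 = 0"
    using int mean ge
    by (subst integral_nonneg_eq_0_iff_AE[symmetric]) (auto simp: AE_measure_pmf_iff)
  then have "set_pmf q \<subseteq> {1}" by (auto simp: AE_measure_pmf_iff)
  then show False using assms(3) by (simp add: set_pmf_subset_singleton)
qed

lemma expectation_rescale_diff:
  fixes h :: "real \<Rightarrow> real"
  assumes h: "1-lipschitz_on UNIV h"
    and sq: "integrable (measure_pmf \<mu>) (\<lambda>z. real z ^ 2)"
    and mean: "measure_pmf.expectation \<mu> real = 1"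
  shows "\<bar>measure_pmf.expectation \<mu> (\<lambda>z. if z = 0 then 0 else h (c * real z))
      - measure_pmf.expectation \<mu> (\<lambda>z. if z = 0 then 0 else h (d * real z))\<bar> \<le> \<bar>c - d\<bar>"
proof -
  define G where "G c z = (if z = 0 then 0 else h (c * real z))" for c and z :: nat
  note int = integrable_real_of_square[OF sq]
  have G_int: "integrable \<mu> (G c)" for c
  proof (rule Bochner_Integration.integrable_bound)
    show "integrable \<mu> (\<lambda>z. \<bar>h 0\<bar> + \<bar>c\<bar> * real z)" using int by simp
    show "AE z in \<mu>. norm (G c z) \<le> norm (\<bar>h 0\<bar> + \<bar>c\<bar> * real z)"
    proof (intro AE_I2)
      fix z
      have "\<bar>h (c * real z) - h 0\<bar> \<le> \<bar>c\<bar> * real z"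
        using lipschitz_abs_diff[OF h, of "c * real z" 0] by (simp add: abs_mult)
      then show "norm (G c z) \<le> norm (\<bar>h 0\<bar> + \<bar>c\<bar> * real z)"
        unfolding G_def by (smt (verit) real_norm_def zero_less_mult_iff)
    qed
  qed simp
  have "\<bar>measure_pmf.expectation \<mu> (G c) - measure_pmf.expectation \<mu> (G d)\<bar>
      = \<bar>measure_pmf.expectation \<mu> (\<lambda>z. G c z - G d z)\<bar>"
    using G_int by simp
  also have "\<dots> \<le> measure_pmf.expectation \<mu> (\<lambda>z. \<bar>G c z - G d z\<bar>)"
    by (rule integral_abs_bound)
  also have "\<dots> \<le> measure_pmf.expectation \<mu> (\<lambda>z. \<bar>c - d\<bar> * real z)"
  proof (rule integral_mono)
    show "\<bar>G c z - G d z\<bar> \<le> \<bar>c - d\<bar> * real z" for z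
      using lipschitz_abs_diff[OF h, of "c * real z" "d * real z"]
      by (simp add: G_def abs_mult flip: left_diff_distrib)
  qed (use G_int int in auto)
  also have "\<dots> = \<bar>c - d\<bar>" using mean by simp
  finally show ?thesis unfolding G_def .
qed

lemma wasserstein_dist_leI:
  assumes "\<And>h. 1-lipschitz_on UNIV h \<Longrightarrow> \<bar>integral\<^sup>L \<mu> h - integral\<^sup>L \<nu> h\<bar> \<le> c"
  shows "wasserstein_dist \<mu> \<nu> \<le> ereal c"
  unfolding wasserstein_dist_def
proof (rule SUP_least)
  fix f assume "f \<in> wasserstein_test"
  then obtain L where f: "L-lipschitz_on UNIV f"
      "AE x in lborel. f differentiable (at x) \<and> \<bar>deriv f x\<bar> \<le> 1"
    by (auto simp: wasserstein_test_def)
  have "1-lipschitz_on UNIV f"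
  proof (rule lipschitz_onI)
    fix x y :: real
    show "dist (f x) (f y) \<le> 1 * dist x y"
      using lipschitz_AE_deriv_bound[OF f, of x y] lipschitz_AE_deriv_bound[OF f, of y x]
      by (cases "x \<le> y") (auto simp: dist_real_def)
  qed simp
  then show "ereal \<bar>integral\<^sup>L \<mu> f - integral\<^sup>L \<nu> f\<bar> \<le> ereal c"
    using assms by simp
qed

theorem theorem1p2:
  fixes M :: "'a measure"
    and q :: "nat pmf"
    and \<xi> :: "nat \<Rightarrow> nat \<Rightarrow> 'a \<Rightarrow> nat"
    and Z :: "nat \<Rightarrow> 'a \<Rightarrow> nat"
    and \<sigma> :: real
  assumes GW: "galton_watson M q \<xi> Z"
    and nontrivial: "pmf q 0 + pmf q 1 < 1"
    and nondegenerate: "\<And>k. pmf q k \<noteq> 1"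
    and mean_integrable: "integrable M (\<lambda>\<omega>. real (Z 1 \<omega>))"
    and critical: "prob_space.expectation M (\<lambda>\<omega>. real (Z 1 \<omega>)) = 1"
    and second_moment: "integrable M (\<lambda>\<omega>. real (Z 1 \<omega>) ^ 2)"
    and variance: "\<sigma>\<^sup>2 = prob_space.variance M (\<lambda>\<omega>. real (Z 1 \<omega>))"
    and third_moment: "integrable M (\<lambda>\<omega>. real (Z 1 \<omega>) ^ 3)"
  shows "\<exists>C::real. C > 0 \<and> (\<forall>n::nat. n \<ge> 2 \<longrightarrow>
      wasserstein_dist
        (cond_law M (\<lambda>\<omega>. 2 / (\<sigma>\<^sup>2 * real n) * real (Z n \<omega>)) (\<lambda>\<omega>. Z n \<omega> > 0))
        (density lborel (\<lambda>x. ennreal (exponential_density 1 x)))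
      \<le> ereal (C * (ln (real n) / real n))
    \<and> wasserstein_dist
        (cond_law M (\<lambda>\<omega>. \<P>(\<omega>' in M. Z n \<omega>' > 0) * real (Z n \<omega>)) (\<lambda>\<omega>. Z n \<omega> > 0))
        (density lborel (\<lambda>x. ennreal (exponential_density 1 x)))
      \<le> ereal (C * (ln (real n) / real n)))"
proof -
  interpret galton_watson M q \<xi> Z by (rule GW)
  have law1: "gw_law q 1 = q"
    unfolding One_nat_def gw_law_Suc' by (simp add: bind_return_pmf pmf.map_ident_strong)
  have q3: "integrable q (\<lambda>z. real z ^ 3)"
    by (rule integrable_Z[of "\<lambda>z. real z ^ 3" 1, unfolded law1, THEN iffD1, OF third_moment])
  have qm: "integrable q real"
    by (rule integrable_Z[of real 1, unfolded law1, THEN iffD1, OF mean_integrable])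
  have q1: "measure_pmf.expectation q real = 1"
    by (rule trans[OF integral_Z[of real 1, unfolded law1, symmetric] critical])
  have q0: "0 < pmf q 0"
    by (rule pmf_0_pos_of_mean_1[OF qm q1 nondegenerate])
  have q0': "pmf q 0 < 1"
    using nondegenerate[of 0] pmf_le_1[of q 0] by linarith
  note facts = q3 q1 q0 q0'
  define v where "v = half_var q"
  have "\<sigma>\<^sup>2 = 2 * v"
  proof -
    have "\<sigma>\<^sup>2 = measure_pmf.expectation q (\<lambda>z. (real z - 1) ^ 2)"
      unfolding variance critical by (rule integral_Z[of "\<lambda>z. (real z - 1) ^ 2" 1, unfolded law1])
    also have "\<dots> = measure_pmf.expectation q (\<lambda>z. real z ^ 2 - 2 * real z + 1)"
      by (simp add: power2_diff algebra_simps)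
    also have "\<dots> = 2 * v"
      using offspring_square[OF facts] qm q1 by (simp add: v_def half_var_def)
    finally show ?thesis .
  qed
  then have scale: "2 / (\<sigma>\<^sup>2 * real n) = 1 / (v * real n)" for n by simp
  \<comment> \<open>As all survive at time 0, the two bounds on survival at time 1 read
    \<open>1 - v\<close> and \<open>1 - pmf q 0\<close>, so \<open>v \<ge> pmf q 0\<close>.\<close>
  have v: "0 < v"
    using gw_survival_Suc_ge2[OF facts, of 0] gw_survival_Suc_le1[OF facts, of 0] q0
    by (simp add: gw_survival_0 v_def)
  define T where "T = measure_pmf.expectation q (\<lambda>k. real k ^ 3)"
  define D where "D = v / (1 - pmf q 0) * measure_pmf.expectation q (\<lambda>k. real k ^ 2) + T"
  define D' where "D' = (v ^ 2 + T) / (1 - pmf q 0)"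
  define K where "K = 2 + 3 / pmf q 0"
  have T: "0 \<le> T" by (simp add: T_def)
  have D: "0 \<le> D" "0 \<le> D'" and K: "0 < K"
    using v T q0 q0' by (auto simp: D_def D'_def K_def intro!: add_nonneg_nonneg add_pos_pos)
  \<comment> \<open>\<open>C1\<close> is the factor \<open>5 + 2 * w\<close> of the Stein bound,
    with \<open>5 \<le> 10 * ln n\<close> and \<open>w \<le> D * K * ln n\<close>, times
    \<open>p\<^sub>n \<le> 1 / (pmf q 0 * n)\<close>. \<open>C2\<close> is the error of
    \<open>1/p\<^sub>n\<close> against \<open>v * n\<close>, relative to
    \<open>v * n\<close>.\<close>
  define C1 where "C1 = (10 + 2 * D * K) / pmf q 0"
  define C2 where "C2 = (2 + D' * K) / v"
  have C: "0 < C1" "0 < C2"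
    using D K q0 v by (auto simp: C1_def C2_def intro!: divide_pos_pos add_pos_nonneg)
  have main: "\<bar>(\<integral>x. h x \<partial>cond_law M (\<lambda>\<omega>. gw_survival q n * real (Z n \<omega>)) (\<lambda>\<omega>. Z n \<omega> > 0))
        - integral\<^sup>L exponential_law h\<bar> \<le> C1 * (ln (real n) / real n)"
    "\<bar>(\<integral>x. h x \<partial>cond_law M (\<lambda>\<omega>. 1 / (v * real n) * real (Z n \<omega>)) (\<lambda>\<omega>. Z n \<omega> > 0))
        - integral\<^sup>L exponential_law h\<bar> \<le> (C1 + C2) * (ln (real n) / real n)"
    if n: "2 \<le> n" and h: "1-lipschitz_on UNIV h" for n h
  proof -
    let ?p = "gw_survival q n" and ?S = "\<Sum>j<n. gw_survival q j" and ?\<mu> = "gw_law q n"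
    let ?E = "\<lambda>c. measure_pmf.expectation ?\<mu> (\<lambda>z. if z = 0 then 0 else h (c * real z))"
    have p: "0 < ?p" by (rule gw_survival_pos[OF facts])
    have \<mu>: "integrable ?\<mu> (\<lambda>z. real z ^ 2)" "measure_pmf.expectation ?\<mu> real = 1"
      using gw_law_moments[OF offspring_square[OF facts] q1] by auto
    have S: "?S \<le> K * ln (real n)"
      unfolding K_def by (rule sum_gw_survival_le_ln[OF facts n])
    have "ln 2 \<le> ln (real n)" using n by simp
    then have ln: "1 \<le> 2 * ln (real n)" using ln2_ge_two_thirds by linarith
    have h_meas: "h \<in> borel_measurable borel" by (rule lipschitz_on_borel_measurable[OF h])
    have "\<bar>?E ?p / ?p - integral\<^sup>L exponential_law h\<bar> \<le> ?p * (5 + 2 * (D * ?S))"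
      using exponential_approximation[OF h \<mu>, of "D * ?S"] yaglom_discrepancy[OF facts, of _ n] p
      unfolding gw_survival_def[of q n] D_def T_def v_def by simp
    also have "\<dots> \<le> 1 / (pmf q 0 * real n) * (5 * (2 * ln (real n)) + 2 * (D * (K * ln (real n))))"
      using gw_survival_le[OF facts, of n] n p ln S D
      by (intro mult_mono add_mono mult_left_mono add_nonneg_nonneg mult_nonneg_nonneg sum_nonneg
          gw_survival_bounds) auto
    also have "\<dots> = C1 * (ln (real n) / real n)"
      by (simp add: C1_def add_divide_distrib distrib_right)
    finally have first: "\<bar>?E ?p / ?p - integral\<^sup>L exponential_law h\<bar> \<le> C1 * (ln (real n) / real n)" .
    then show "\<bar>(\<integral>x. h x \<partial>cond_law M (\<lambda>\<omega>. ?p * real (Z n \<omega>)) (\<lambda>\<omega>. Z n \<omega> > 0))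
        - integral\<^sup>L exponential_law h\<bar> \<le> C1 * (ln (real n) / real n)"
      by (simp only: integral_cond_law[OF h_meas p])
    let ?c = "1 / (v * real n)"
    \<comment> \<open>Changing the scale moves the conditional mean of a 1-Lipschitz function by at
      most the change times the conditional mean of \<open>Z n\<close>, which is
      \<open>1 / ?p\<close>.\<close>
    have "\<bar>?E ?c / ?p - ?E ?p / ?p\<bar> \<le> \<bar>?c - ?p\<bar> / ?p"
      using expectation_rescale_diff[OF h \<mu>, of ?c ?p] p
      by (simp add: divide_right_mono flip: diff_divide_distrib)
    also have "\<dots> = \<bar>1 / ?p - v * real n\<bar> / (v * real n)"
    proof -
      have "(?c - ?p) / ?p = (1 / ?p - v * real n) / (v * real n)"
        using p v n by (simp add: field_simps)
      then have "\<bar>(?c - ?p) / ?p\<bar> = \<bar>(1 / ?p - v * real n) / (v * real n)\<bar>" by simp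
      then show ?thesis using p v by (simp add: abs_divide abs_mult)
    qed
    also have "\<dots> \<le> (2 * ln (real n) + D' * (K * ln (real n))) / (v * real n)"
    proof (rule divide_right_mono)
      have "\<bar>1 / ?p - v * real n\<bar> \<le> 1 + D' * ?S"
        using inverse_gw_survival_asymp[OF facts, of n] by (simp add: v_def D'_def T_def)
      also have "\<dots> \<le> 2 * ln (real n) + D' * (K * ln (real n))"
        by (intro add_mono mult_left_mono ln S D)
      finally show "\<bar>1 / ?p - v * real n\<bar> \<le> 2 * ln (real n) + D' * (K * ln (real n))" .
    qed (use v in simp)
    also have "\<dots> = C2 * (ln (real n) / real n)"
      by (simp add: C2_def add_divide_distrib distrib_right)
    finally show "\<bar>(\<integral>x. h x \<partial>cond_law M (\<lambda>\<omega>. ?c * real (Z n \<omega>)) (\<lambda>\<omega>. Z n \<omega> > 0))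
        - integral\<^sup>L exponential_law h\<bar> \<le> (C1 + C2) * (ln (real n) / real n)"
      unfolding integral_cond_law[OF h_meas p] distrib_right using first by (smt (verit))
  qed
  show ?thesis
  proof (intro exI[of _ "C1 + C2"] conjI allI impI)
    show "0 < C1 + C2" using C by simp
    fix n :: nat assume n: "2 \<le> n"
    show "wasserstein_dist
        (cond_law M (\<lambda>\<omega>. 2 / (\<sigma>\<^sup>2 * real n) * real (Z n \<omega>)) (\<lambda>\<omega>. Z n \<omega> > 0))
        exponential_law \<le> ereal ((C1 + C2) * (ln (real n) / real n))"
      unfolding scale by (rule wasserstein_dist_leI) (rule main(2)[OF n])
    have "0 \<le> C2 * (ln (real n) / real n)" using C n by simp
    then have le: "C1 * (ln (real n) / real n) \<le> (C1 + C2) * (ln (real n) / real n)"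
      unfolding distrib_right by simp
    show "wasserstein_dist
        (cond_law M (\<lambda>\<omega>. \<P>(\<omega>' in M. Z n \<omega>' > 0) * real (Z n \<omega>)) (\<lambda>\<omega>. Z n \<omega> > 0))
        exponential_law \<le> ereal ((C1 + C2) * (ln (real n) / real n))"
      unfolding prob_Z_pos by (rule wasserstein_dist_leI) (rule order_trans[OF main(1)[OF n] le])
  qed
qed

end
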